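(* For $k\ge2$, the Mahler measure $\mathrm m(C_k)$ is bounded away from zero; more specifically, $$0.28\le\mathrm m(x^3-x-1)\le\inf_{k\ge2}\mathrm m(C_k)\le\mathrm m(C_2)\le0.33.$$
   Context: For a nonzero Laurent polynomial $f$ in $N$ variables, $\mathrm m(f):=\int_{\mathbf T^N}\log|f|\,d\mu$, with $\mathbf T$ the complex unit circle and $\mu$ normalized Haar measure. For $k\ge1$ let $d=\phi(k)$ and $\zeta_k$ a primitive $k$-th root of unity. Every $k$-th root of unity is uniquely an integer linear combination of $1,\zeta_k,\dots,\zeta_k^{d-1}$; let $A_k\subset\mathbf Z^d$ be the set of the $k$ coefficient vectors, and $F_k(\mathbf x):=\sum_{\mathbf a\in A_k}\mathbf x^{\mathbf a}$ with $\mathbf x=(x_1,\dots,x_d)$. The cyclovariety $C_k$ is the hypersurface $x_0+F_k(\mathbf x)=0$ in $\mathbf G_m^{d+1}$, and $\mathrm m(C_k):=\mathrm m(x_0+F_k(\mathbf x))$ as a Laurent polynomial in $d+1$ variables. *)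

theory Defs
  imports "HOL-Analysis.Analysis" "HOL-Library.Poly_Mapping" "HOL-Number_Theory.Totient"
begin

text \<open>
  Laurent polynomials over the complex numbers in the variables \<open>x\<^sub>0, x\<^sub>1, x\<^sub>2, \<dots>\<close>, as the group ring
  of the finitely supported integer exponent vectors.  The number of variables is not part of the type,
  because it depends on \<open>k\<close> in the definition of the cyclovariety.
\<close>

type_synonym laurent_poly = "(nat \<Rightarrow>\<^sub>0 int) \<Rightarrow>\<^sub>0 complex"

definition laurent_monom :: "(nat \<Rightarrow>\<^sub>0 int) \<Rightarrow> laurent_poly" where
  "laurent_monom a = Poly_Mapping.single a 1"

definition laurent_var :: "nat \<Rightarrow> laurent_poly" where
  "laurent_var i = laurent_monom (Poly_Mapping.single i 1)"

definition laurent_eval :: "laurent_poly \<Rightarrow> (nat \<Rightarrow> complex) \<Rightarrow> complex" where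
  "laurent_eval f x =
     (\<Sum>a\<in>Poly_Mapping.keys f. Poly_Mapping.lookup f a *
        (\<Prod>i\<in>Poly_Mapping.keys a. x i powi Poly_Mapping.lookup a i))"

text \<open>Normalized Haar measure on the unit circle: normalized arc length.\<close>

definition circle_haar :: "complex measure" where
  "circle_haar =
     distr (uniform_measure lborel {0..2 * pi}) (restrict_space borel (sphere 0 1)) cis"

text \<open>
  The logarithmic Mahler measure of \<open>f\<close> as a Laurent polynomial in the \<open>N\<close> variables
  \<open>x\<^sub>0, \<dots>, x\<^bsub>N-1\<^esub>\<close>; it is meant for nonzero \<open>f\<close> in which no other variable occurs.  For such \<open>f\<close> the
  zeros on the torus form a null set, so the convention \<^term>\<open>ln (0::real) = 0\<close> has no effect.
\<close>

definition log_mahler_measure :: "nat \<Rightarrow> laurent_poly \<Rightarrow> real" where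
  "log_mahler_measure N f =
     (\<integral>x. ln (cmod (laurent_eval f x)) \<partial>(\<Pi>\<^sub>M i\<in>{..<N}. circle_haar))"

definition primitive_root_of_unity :: "nat \<Rightarrow> complex \<Rightarrow> bool" where
  "primitive_root_of_unity k z \<longleftrightarrow> k \<ge> 1 \<and> z ^ k = 1 \<and> (\<forall>m. 0 < m \<and> m < k \<longrightarrow> z ^ m \<noteq> 1)"

text \<open>
  The coefficient vectors of the \<open>k\<close>-th roots of unity with respect to \<open>1, z, \<dots>, z\<^bsup>d-1\<^esup>\<close>, where \<open>d\<close> is
  the totient of \<open>k\<close>.  The coordinates are numbered from 1 to \<open>d\<close>, the variable \<open>x\<^sub>0\<close> being reserved.
\<close>

definition cyclo_exponents :: "nat \<Rightarrow> complex \<Rightarrow> (nat \<Rightarrow>\<^sub>0 int) set" where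
  "cyclo_exponents k z =
     {a. Poly_Mapping.keys a \<subseteq> {1..totient k} \<and>
         (\<Sum>i=1..totient k. of_int (Poly_Mapping.lookup a i) * z ^ (i - 1)) ^ k = 1}"

definition cyclo_poly :: "nat \<Rightarrow> complex \<Rightarrow> laurent_poly" where
  "cyclo_poly k z = (\<Sum>a\<in>cyclo_exponents k z. laurent_monom a)"

text \<open>
  The Mahler measure of the cyclovariety, the hypersurface \<open>x\<^sub>0 + F\<^sub>k(x\<^sub>1, \<dots>, x\<^sub>d) = 0\<close> in the torus of
  dimension \<open>d + 1\<close>.
\<close>

definition cyclovariety_mahler :: "nat \<Rightarrow> complex \<Rightarrow> real" where
  "cyclovariety_mahler k z =
     log_mahler_measure (totient k + 1) (laurent_var 0 + cyclo_poly k z)"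

end

theory Submission
  imports Defs "HOL-Computational_Algebra.Computational_Algebra" "HOL-Probability.Probability"
begin

text \<open>Jensen's formula integrates out the variable \<open>x\<^sub>0\<close>: for a complex number \<open>w\<close> the mean of \<open>ln |z + w|\<close> over
the unit circle is \<open>max 0 (ln |w|)\<close>.  So the Mahler measure of the cyclovariety is the mean of
\<open>max 0 (ln |F|)\<close> over a torus, where \<open>F\<close> is a sum of \<open>k\<close> distinct monomials.  The three quantities of the
theorem are then separated by the number 0.29: the polynomial \<open>x\<^sup>3 - x - 1\<close> has measure between 0.28 and
0.29, the cyclovariety for \<open>k = 2\<close> has measure between 0.29 and 0.33, and all others have measure at
least 0.29.

For \<open>k \<ge> 3\<close> the bound comes from two moments.  The means of \<open>|F|\<^sup>2\<close> and \<open>|F|\<^sup>4\<close> count the coincidences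
\<open>a = b\<close> and \<open>a + b = c + d\<close> among the exponent vectors.  These vectors correspond, additively and
bijectively, to the \<open>k\<close>-th roots of unity, where conjugation shows that \<open>a + b = c + d\<close> has only the
solutions \<open>{a, b} = {c, d}\<close> and \<open>a + b = 0 = c + d\<close> (\<open>roots_of_unity_energy\<close>).  Hence the moments are \<open>k\<close>
and at most \<open>3 k\<^sup>2\<close>, so \<open>|F|\<^sup>2 / k\<close> cannot concentrate near 0, and a quadratic minorant of
\<open>max 0 (ln t)\<close> makes this quantitative (\<open>mean_log_ge_of_moments\<close>).

The correspondence needs that \<open>1, z, \<dots>, z\<^bsup>d-1\<^esup>\<close> is a basis of the ring generated by a primitive root of
unity \<open>z\<close>, with \<open>d\<close> the totient of \<open>k\<close>, that is, the irreducibility of the cyclotomic polynomial.  Its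
core is \<open>prime_power_preserves_relations\<close>: an integer polynomial vanishing at \<open>z\<close> vanishes at \<open>z\<^sup>p\<close> for
every prime \<open>p\<close> not dividing \<open>k\<close>.

This instance of Jensen's formula rests on two properties of Haar measure on the circle: it is invariant
under \<open>z \<mapsto> - z\<close> and mapped to itself by \<open>z \<mapsto> z\<^sup>2\<close>.  Since \<open>z\<^sup>2 - w\<^sup>2 = (z - w) (z + w)\<close>, the mean \<open>I w\<close> of \<open>ln |z - w|\<close> satisfies
\<open>I (w\<^sup>2) = 2 I w\<close>; being bounded on the unit disc it vanishes there, the boundary included
(\<open>log_dist_integral_unit_disc\<close>).  For \<open>k = 2\<close> the mean is an integral of the logarithm of a sine over an
interval, bounded on both sides by cutting the interval into congruent pieces and evaluating products of
sines; for \<open>x\<^sup>3 - x - 1\<close> Jensen's formula gives the logarithm of its only root outside the unit disc.\<close>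

section \<open>Integer relations among the powers of a root of unity\<close>

abbreviation poly_at :: "int poly \<Rightarrow> complex \<Rightarrow> complex" where
  "poly_at f z \<equiv> poly (map_poly of_int f) z"

lemma poly_at_pCons [simp]: "poly_at (pCons a f) z = of_int a + z * poly_at f z"
  by (simp add: map_poly_pCons)

lemma poly_at_add [simp]: "poly_at (f + g) z = poly_at f z + poly_at g z"
proof -
  have "map_poly of_int (f + g) = map_poly of_int f + map_poly (of_int :: int \<Rightarrow> complex) g"
    by (rule poly_eqI) (simp add: coeff_map_poly)
  then show ?thesis by simp
qed

lemma poly_at_smult [simp]: "poly_at (smult c f) z = of_int c * poly_at f z"
  by (induction f) (simp_all add: algebra_simps)

lemma poly_at_mult [simp]: "poly_at (f * g) z = poly_at f z * poly_at g z"
  by (induction f) (simp_all add: algebra_simps)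

lemma poly_at_diff [simp]: "poly_at (f - g) z = poly_at f z - poly_at g z"
  using poly_at_add[of "f - g" g z] by simp

lemma poly_at_1 [simp]: "poly_at 1 z = 1"
  by (simp add: one_pCons)

lemma poly_at_power [simp]: "poly_at (f ^ n) z = poly_at f z ^ n"
  by (induction n) simp_all

lemma poly_at_monom [simp]: "poly_at (monom c n) z = of_int c * z ^ n"
  by (simp add: map_poly_monom poly_monom)

lemma poly_at_pcompose [simp]: "poly_at (pcompose f g) z = poly_at f (poly_at g z)"
  by (induction f) (simp_all add: pcompose_pCons)

lemma poly_at_sum [simp]: "poly_at (sum f A) z = (\<Sum>i\<in>A. poly_at (f i) z)"
  by (induction A rule: infinite_finite_induct) simp_all

lemma map_poly_pderiv_of_int:
  "map_poly of_int (pderiv f) = pderiv (map_poly (of_int :: int \<Rightarrow> complex) f)"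
  by (rule poly_eqI) (simp add: coeff_map_poly coeff_pderiv)

text \<open>Gauss's lemma: contents multiply, so \<open>a\<close> divides the content of the cofactor and can be cancelled.\<close>

lemma primitive_poly_dvd_cancel:
  fixes f g :: "int poly"
  assumes "Polynomial.content f = 1" "a \<noteq> 0" "f dvd smult a g"
  shows "f dvd g"
proof -
  obtain q where q: "smult a g = f * q" using assms(3) by (auto elim: dvdE)
  then have "normalize a * Polynomial.content g = Polynomial.content q"
    using assms(1) by (metis content_smult content_mult mult_1)
  then have "a dvd Polynomial.content q" by (metis dvd_triv_left normalize_dvd_iff)
  then have "[:a:] dvd q" by (simp add: const_poly_dvd_iff_dvd_content)
  then obtain r where r: "q = smult a r" by (auto elim!: dvdE)
  then have "smult a g = smult a (f * r)" using q by simp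
  then have "g = f * r" using assms(2) by (metis smult_cancel)
  then show ?thesis by simp
qed

text \<open>Among the nonzero integer polynomials that vanish at \<open>z\<close> take one of least degree and divide it by its
content.  Pseudo-division followed by Gauss's lemma shows that it divides all the others; as it divides
\<open>X\<^sup>k - 1\<close>, its leading coefficient is a unit.\<close>

lemma minimal_polynomial_exists:
  assumes "z ^ k = 1" "k \<ge> 1"
  shows "\<exists>f :: int poly. lead_coeff f = 1 \<and> (\<forall>g. poly_at g z = 0 \<longleftrightarrow> f dvd g)"
proof -
  define u :: "int poly" where "u = monom 1 k - 1"
  have coeff_u: "coeff u k = 1" using assms by (simp add: u_def)
  have deg_u: "degree u \<le> k" unfolding u_def
    by (intro degree_diff_le) (auto simp: degree_monom_eq)
  have u: "u \<noteq> 0" "poly_at u z = 0" "lead_coeff u = 1"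
    using coeff_u deg_u assms le_degree[of u k] by (auto simp: u_def dest: le_antisym)
  define P where "P = (\<lambda>f :: int poly. f \<noteq> 0 \<and> poly_at f z = 0)"
  define f0 where "f0 = arg_min degree P"
  have f0: "P f0" "\<And>g. P g \<Longrightarrow> degree f0 \<le> degree g"
    using arg_min_natI[of P u degree] arg_min_nat_le[of P _ degree] u
    by (auto simp: f0_def P_def)
  define f where "f = primitive_part f0"
  have f0f: "f0 = smult (Polynomial.content f0) f" by (simp add: f_def)
  have nz: "Polynomial.content f0 \<noteq> 0" "f \<noteq> 0" using f0 by (auto simp: P_def f_def)
  have cf: "Polynomial.content f = 1" using f0 by (simp add: f_def P_def)
  have fz: "poly_at f z = 0"
    using f0(1) nz f0f unfolding P_def by (metis poly_at_smult mult_eq_0_iff of_int_eq_0_iff)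
  have deg: "degree f = degree f0" using f0f nz by (metis degree_smult_eq)
  have div: "poly_at g z = 0 \<longleftrightarrow> f dvd g" for g
  proof
    assume g: "poly_at g z = 0"
    obtain a q where aq: "a \<noteq> 0" "smult a g = f * q + pseudo_mod g f"
      using pseudo_mod(1)[OF nz(2), of g] by auto
    have "poly_at (smult a g) z = 0" using g by simp
    then have "poly_at (pseudo_mod g f) z = 0" using aq fz by simp
    moreover have "pseudo_mod g f = 0 \<or> degree (pseudo_mod g f) < degree f"
      using pseudo_mod(2)[OF nz(2)] by auto
    ultimately have "pseudo_mod g f = 0"
      using f0(2)[of "pseudo_mod g f"] deg unfolding P_def by linarith
    then show "f dvd g" using primitive_poly_dvd_cancel[OF cf aq(1)] aq(2) by simp
  next
    assume "f dvd g" then show "poly_at g z = 0" using fz by (auto elim!: dvdE)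
  qed
  have "f dvd u" using div u by blast
  then have "lead_coeff f dvd 1" using u(3) by (metis dvdE dvd_triv_left lead_coeff_mult)
  then have "lead_coeff f = 1 \<or> lead_coeff f = - 1" by auto
  then show ?thesis
  proof
    assume "lead_coeff f = 1" then show ?thesis using div by blast
  next
    assume "lead_coeff f = - 1"
    then have "lead_coeff (- f) = 1 \<and> (\<forall>g. poly_at g z = 0 \<longleftrightarrow> - f dvd g)" using div by simp
    then show ?thesis by blast
  qed
qed

text \<open>The congruence is put as a divisibility so that it serves both for integers and for integer polynomials.\<close>

lemma freshman_dream_dvd:
  fixes f g :: "'a :: comm_ring_1"
  assumes "prime p"
  shows "of_nat p dvd (f + g) ^ p - (f ^ p + g ^ p)"
proof -
  have p: "p > 0" using assms prime_gt_0_nat by blast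
  have "(f + g) ^ p = (\<Sum>k\<le>p. of_nat (p choose k) * f ^ k * g ^ (p - k))"
    by (rule binomial_ring)
  also have "{..p} = insert 0 (insert p {0<..<p})" using p by auto
  finally have "(f + g) ^ p - (f ^ p + g ^ p)
      = (\<Sum>k\<in>{0<..<p}. of_nat (p choose k) * f ^ k * g ^ (p - k))"
    using p by simp
  moreover have "of_nat p dvd (of_nat (p choose k) * f ^ k * g ^ (p - k) :: 'a)"
    if "k \<in> {0<..<p}" for k
  proof -
    have "p dvd p choose k" using dvd_choose_prime[of k p] that assms p by auto
    then have "(of_nat p :: 'a) dvd of_nat (p choose k)" by (auto elim!: dvdE)
    then show ?thesis by (simp add: dvd_mult2)
  qed
  ultimately show ?thesis by (auto intro!: dvd_sum)
qed

lemma int_fermat: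
  assumes "prime p"
  shows "int p dvd a ^ p - a"
proof (induction a rule: int_induct[where k = 0])
  case base
  then show ?case using assms prime_gt_0_nat[of p] by (simp add: zero_power)
next
  case (step1 a)
  have "(a + 1) ^ p - (a + 1) = ((a + 1) ^ p - (a ^ p + 1 ^ p)) + (a ^ p - a)" by simp
  then show ?case using step1 freshman_dream_dvd[OF assms, of a 1] by (metis dvd_add)
next
  case (step2 a)
  have "(a - 1) ^ p - (a - 1) = (a ^ p - a) - ((a - 1 + 1) ^ p - ((a - 1) ^ p + 1 ^ p))" by simp
  then show ?case using step2 freshman_dream_dvd[OF assms, of "a - 1" 1] by (metis dvd_diff)
qed

text \<open>Modulo \<open>p\<close> the substitution of \<open>X\<^sup>p\<close> is the \<open>p\<close>-th power: it agrees with it on constants, by Fermat, and on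
\<open>X\<close>, and both are additive modulo \<open>p\<close>.\<close>

lemma frobenius_dvd:
  fixes g :: "int poly"
  assumes "prime p"
  shows "[:int p:] dvd pcompose g (monom 1 p) - g ^ p"
proof (induction g)
  case 0
  then show ?case using assms prime_gt_0_nat[of p] by (simp add: zero_power)
next
  case (pCons a g)
  have e: "pCons a g = [:a:] + monom 1 1 * g" by (simp add: monom_altdef)
  have "pcompose (pCons a g) (monom 1 p) - pCons a g ^ p
     = ([:a:] - [:a:] ^ p) + monom 1 p * (pcompose g (monom 1 p) - g ^ p)
       - (([:a:] + monom 1 1 * g) ^ p - ([:a:] ^ p + (monom 1 1 * g) ^ p))"
    unfolding e by (simp add: pcompose_pCons power_mult_distrib monom_power algebra_simps)
      (simp add: pcompose_add pcompose_mult monom_altdef pcompose_pCons algebra_simps)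
  moreover have "[:int p:] dvd [:a:] - [:a:] ^ p"
  proof -
    have "int p dvd a - a ^ p" using int_fermat[OF assms, of a] by (simp add: dvd_diff_commute)
    then show ?thesis by (simp add: poly_const_pow)
  qed
  ultimately show ?case
    using pCons.IH freshman_dream_dvd[OF assms, of "[:a:]" "monom 1 1 * g"] unfolding of_nat_poly
    by (metis dvd_add dvd_diff dvd_mult)
qed

lemma monic_div:
  fixes f g :: "int poly"
  assumes "lead_coeff f = 1"
  shows "\<exists>q r. g = f * q + r \<and> (r = 0 \<or> degree r < degree f)"
proof -
  have "f \<noteq> 0" using assms by auto
  obtain q r where "pseudo_divmod g f = (q, r)" by force
  from pseudo_divmod[OF \<open>f \<noteq> 0\<close> this] show ?thesis
    unfolding assms power_one smult_1_left by blast
qed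

text \<open>Let \<open>f\<close> be the minimal polynomial of \<open>z\<close> and \<open>X\<^sup>k - 1 = f g\<close>.  If \<open>f\<close> did not vanish at \<open>z\<^sup>p\<close>, then \<open>g\<close> would,
and by Frobenius \<open>g(z)\<^sup>p\<close> would be \<open>p\<close> times an element of the ring generated by \<open>z\<close>.  Differentiating
\<open>f g\<close> gives \<open>f'(z) g(z) = k z\<^bsup>k-1\<^esup>\<close>, so \<open>k\<^sup>p\<close> would be \<open>p\<close> times an element of that ring as well.  The powers
of \<open>z\<close> below the degree of \<open>f\<close> are independent over the integers; comparing the constant coefficients
yields \<open>p dvd k\<^sup>p\<close>.\<close>

lemma prime_power_preserves_relations:
  assumes z: "z ^ k = 1" "k \<ge> 1" and p: "prime p" "\<not> p dvd k" and h: "poly_at h z = 0"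
  shows "poly_at h (z ^ p) = 0"
proof -
  obtain f :: "int poly" where f: "lead_coeff f = 1" and div: "\<And>g. poly_at g z = 0 \<longleftrightarrow> f dvd g"
    using minimal_polynomial_exists[OF z] by blast
  have fz: "poly_at f z = 0" using div[of f] by simp
  define u :: "int poly" where "u = monom 1 k - 1"
  have "poly_at u z = 0" using z by (simp add: u_def)
  then obtain g where g: "u = f * g" using div by (auto elim: dvdE)
  have "poly_at f (z ^ p) = 0"
  proof (rule ccontr)
    assume nz: "poly_at f (z ^ p) \<noteq> 0"
    have "poly_at u (z ^ p) = 0" using z by (simp add: u_def) (metis mult.commute power_mult power_one)
    then have "poly_at g (z ^ p) = 0" using nz g by simp
    then have *: "poly_at (pcompose g (monom 1 p)) z = 0" by simp
    obtain w where "pcompose g (monom 1 p) - g ^ p = [:int p:] * w"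
      using frobenius_dvd[OF p(1), of g] by (auto elim: dvdE)
    then have "poly_at (pcompose g (monom 1 p)) z - poly_at (g ^ p) z = of_nat p * poly_at w z"
      by (metis poly_at_diff poly_at_smult mult_pCons_left mult_zero_left pCons_0_0 add_0_right of_int_of_nat_eq)
    then have gp: "poly_at g z ^ p = - of_nat p * poly_at w z"
      using * by (metis diff_0 minus_minus mult_minus_left poly_at_power)
    have "poly_at (pderiv u) z = poly_at (pderiv f) z * poly_at g z"
      unfolding g using fz by (simp add: pderiv_mult algebra_simps)
    moreover have "pderiv u = monom (int k) (k - 1)" by (simp add: u_def pderiv_diff pderiv_monom)
    ultimately have dz: "of_nat k * z ^ (k - 1) = poly_at (pderiv f) z * poly_at g z" by simp
    define U where "U = - (pderiv f ^ p * monom 1 p * w)"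
    have "of_nat k = (of_nat k * z ^ (k - 1)) * z"
      using z power_minus_mult[of k z] by (simp add: mult.assoc)
    then have "of_nat k = poly_at (pderiv f) z * poly_at g z * z" by (simp only: dz)
    then have "of_nat k ^ p = (poly_at (pderiv f) z * poly_at g z * z) ^ p" by (rule arg_cong)
    also have "\<dots> = poly_at (pderiv f) z ^ p * z ^ p * poly_at g z ^ p" by (simp add: power_mult_distrib)
    also have "\<dots> = of_nat p * poly_at U z" unfolding gp U_def
      using poly_at_diff[of 0 "pderiv f ^ p * monom 1 p * w" z] by simp
    finally have kU: "of_nat k ^ p = of_nat p * poly_at U z" .
    \<comment> \<open>Reducing \<open>U\<close> modulo \<open>f\<close> yields a relation of degree below that of \<open>f\<close>, which must be trivial.\<close>
    obtain q r where qr: "U = f * q + r" "r = 0 \<or> degree r < degree f" using monic_div[OF f] by blast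
    define W where "W = [:int k ^ p:] - smult (int p) r"
    have "poly_at W z = 0" using kU qr(1) fz by (simp add: W_def)
    then have "f dvd W" using div[of W] by simp
    moreover have "degree f > 0"
    proof (rule ccontr)
      assume "\<not> degree f > 0"
      then have "f = 1" using f by (metis degree_eq_zeroE neq0_conv lead_coeff_pCons(2) one_pCons)
      then show False using fz by simp
    qed
    then have "degree W < degree f" unfolding W_def using qr(2) by (intro degree_diff_less) auto
    ultimately have "W = 0" using divides_degree[of f W] by auto
    then have "coeff W 0 = 0" by simp
    then have "int k ^ p = int p * coeff r 0" by (simp add: W_def)
    then have "int p dvd int k ^ p" by simp
    then have "p dvd k ^ p" by (metis of_nat_dvd_iff of_nat_power)
    then show False using p prime_dvd_power by blast
  qed
  moreover have "f dvd h" using h div[of h] by simp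
  ultimately show ?thesis by (auto elim!: dvdE)
qed

text \<open>The exponent is a product of primes that do not divide \<open>k\<close>, and \<open>z\<^sup>p\<close> is again a \<open>k\<close>-th root of unity.\<close>

lemma coprime_power_preserves_relations:
  assumes "z ^ k = 1" "k \<ge> 1" "coprime j k" "j > 0" "poly_at h z = 0"
  shows "poly_at h (z ^ j) = 0"
  using assms
proof (induction j arbitrary: z rule: less_induct)
  case (less j)
  show ?case
  proof (cases "j = 1")
    case True
    then show ?thesis using less by simp
  next
    case False
    then obtain p where p: "prime p" "p dvd j" using prime_factor_nat by blast
    then obtain m where m: "j = p * m" by (auto elim: dvdE)
    have "m < j" "m > 0" using m less.prems(4) prime_gt_1_nat[OF p(1)] by auto
    have "coprime p k" using less.prems(3) m by simp
    then have "\<not> p dvd k" using p(1) by (metis coprime_absorb_left not_prime_unit)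
    then have "poly_at h (z ^ p) = 0"
      using prime_power_preserves_relations[OF less.prems(1,2) p(1)] less.prems(5) by blast
    moreover have "(z ^ p) ^ k = 1"
      using less.prems(1) by (metis power_mult mult.commute power_one)
    moreover have "coprime m k" using less.prems(3) m by simp
    ultimately have "poly_at h ((z ^ p) ^ m) = 0"
      using less.IH[of m "z ^ p"] \<open>m < j\<close> \<open>m > 0\<close> less.prems(2) by blast
    then show ?thesis by (simp add: m power_mult)
  qed
qed

lemma primitive_root_power_inj:
  assumes "primitive_root_of_unity k z"
  shows "inj_on (\<lambda>j. z ^ j) {0<..k}"
proof -
  have z: "z ^ k = 1" "k \<ge> 1" and min: "\<And>m. 0 < m \<Longrightarrow> m < k \<Longrightarrow> z ^ m \<noteq> 1"
    using assms by (auto simp: primitive_root_of_unity_def)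
  have nz: "z \<noteq> 0" using z by (metis power_0_left zero_neq_one not_one_le_zero)
  have "i = j" if "i \<in> {0<..k}" "j \<in> {0<..k}" "z ^ i = z ^ j" "i \<le> j" for i j
  proof (rule ccontr)
    assume "i \<noteq> j"
    have "z ^ i * z ^ (j - i) = z ^ (i + (j - i))" by (rule power_add[symmetric])
    then have "z ^ i * z ^ (j - i) = z ^ i * 1" using that by simp
    then have "z ^ (j - i) = 1" using nz by simp
    then show False using min[of "j - i"] that \<open>i \<noteq> j\<close> by fastforce
  qed
  then show ?thesis unfolding inj_on_def by (metis nat_le_linear)
qed

lemma primitive_root_powers:
  assumes "primitive_root_of_unity k z"
  shows "(\<lambda>j. z ^ j) ` {0<..k} = {w. w ^ k = 1}"
proof (rule card_subset_eq)
  have z: "z ^ k = 1" "k \<ge> 1" using assms by (auto simp: primitive_root_of_unity_def)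
  show "finite {w::complex. w ^ k = 1}" using z(2) by (intro finite_roots_unity) auto
  show "(\<lambda>j. z ^ j) ` {0<..k} \<subseteq> {w. w ^ k = 1}"
    using z(1) by auto (metis mult.commute power_mult power_one)
  show "card ((\<lambda>j. z ^ j) ` {0<..k}) = card {w::complex. w ^ k = 1}"
    using card_image[OF primitive_root_power_inj[OF assms]] card_roots_unity_eq[of k] z(2) by simp
qed

text \<open>The polynomial has at least the \<open>totient k\<close> roots \<open>z\<^sup>j\<close> with \<open>j\<close> coprime to \<open>k\<close>.\<close>

lemma cyclotomic_degree_le:
  assumes "primitive_root_of_unity k z" "poly_at h z = 0" "h \<noteq> 0"
  shows "totient k \<le> degree h"
proof -
  let ?h = "map_poly of_int h :: complex poly"
  have z: "z ^ k = 1" "k \<ge> 1" using assms by (auto simp: primitive_root_of_unity_def)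
  have h0: "?h \<noteq> 0" using assms(3) by (simp add: map_poly_eq_0_iff)
  have "(\<lambda>j. z ^ j) ` totatives k \<subseteq> {x. poly ?h x = 0}"
    using coprime_power_preserves_relations[OF z _ _ assms(2)] by (auto simp: totatives_def)
  moreover have "inj_on (\<lambda>j. z ^ j) (totatives k)"
    using primitive_root_power_inj[OF assms(1)] by (rule inj_on_subset) (auto simp: totatives_def)
  ultimately have "totient k \<le> card {x. poly ?h x = 0}"
    unfolding totient_def using card_mono[OF poly_roots_finite[OF h0]] card_image by metis
  also have "\<dots> \<le> degree ?h" using card_poly_roots_bound[OF h0] .
  also have "\<dots> \<le> degree h" by (simp add: degree_map_poly)
  finally show ?thesis .
qed

text \<open>The minimal polynomial \<open>f\<close> of \<open>z\<close> is a divisor of \<open>X\<^sup>k - 1\<close>, so its roots are simple, and it remains to see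
that they are primitive.  A root \<open>w\<close> with \<open>w\<^sup>m = 1\<close> for a proper divisor \<open>m\<close> of \<open>k\<close> would be a zero of
\<open>X\<^sup>m - 1\<close>; since \<open>z\<close> is not, \<open>f\<close> divides the cofactor of \<open>X\<^sup>m - 1\<close> in \<open>X\<^sup>k - 1\<close>, which makes \<open>w\<close> a double
zero of \<open>X\<^sup>k - 1\<close>.\<close>

lemma cyclotomic_polynomial_exists:
  assumes prim: "primitive_root_of_unity k z"
  shows "\<exists>f. lead_coeff f = 1 \<and> degree f \<le> totient k \<and> poly_at f z = 0"
proof -
  have z: "z ^ k = 1" "k \<ge> 1" using prim by (auto simp: primitive_root_of_unity_def)
  obtain f :: "int poly" where f: "lead_coeff f = 1" and div: "\<And>g. poly_at g z = 0 \<longleftrightarrow> f dvd g"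
    using minimal_polynomial_exists[OF z] by blast
  let ?f = "map_poly of_int f :: complex poly"
  define X where "X = (\<lambda>m. monom 1 m - 1 :: int poly)"
  have X_at: "poly_at (X m) w = w ^ m - 1" for m w by (simp add: X_def)
  \<comment> \<open>A common zero of two complementary factors would be a double zero of \<open>X\<^sup>k - 1\<close>.\<close>
  have no_double: False
    if "poly_at a w = 0" "poly_at b w = 0" "X k = a * b" for a b w
  proof -
    have "poly_at (X k) w = 0" using that by simp
    then have wk: "w ^ k = 1" using X_at by simp
    have "poly_at (pderiv (X k)) w = 0" unfolding that(3) using that(1,2) by (simp add: pderiv_mult)
    then have "of_nat k * w ^ (k - 1) = 0" by (simp add: X_def pderiv_diff pderiv_monom)
    then have "w ^ (k - 1) = 0" using z(2) by simp
    then show False using wk z(2) by (metis power_minus_mult mult_zero_left zero_neq_one less_le_trans zero_less_one)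
  qed
  have "f dvd X k" using div[of "X k"] z X_at by simp
  then obtain g where g: "X k = f * g" by (rule dvdE)
  have roots: "{w. poly ?f w = 0} \<subseteq> (\<lambda>j. z ^ j) ` totatives k"
  proof
    fix w assume "w \<in> {w. poly ?f w = 0}"
    then have fw: "poly_at f w = 0" by simp
    then have "poly_at (X k) w = 0" unfolding g by simp
    then have "w ^ k = 1" using X_at by simp
    then have "w \<in> (\<lambda>j. z ^ j) ` {0<..k}" using primitive_root_powers[OF prim] by simp
    then obtain j where j: "j \<in> {0<..k}" "w = z ^ j" by blast
    have "coprime j k"
    proof (rule ccontr)
      assume nc: "\<not> coprime j k"
      define d where "d = gcd j k"
      have d: "d > 1" "d dvd j" "d dvd k" using nc j unfolding d_def
        by (auto simp: coprime_iff_gcd_eq_1 nat_neq_iff)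
      define m where "m = k div d"
      have km: "k = m * d" using d(3) by (simp add: m_def)
      then have m: "0 < m" "m < k" using d(1) z(2) by auto
      obtain i where i: "j = d * i" using d(2) by (auto elim: dvdE)
      have "w ^ m = (z ^ k) ^ i" unfolding j(2) i power_mult[symmetric] km by (simp add: mult_ac)
      then have wm: "poly_at (X m) w = 0" using z(1) X_at by simp
      have "X k = X m * (\<Sum>i<d. monom 1 m ^ i)"
        unfolding X_def using power_diff_1_eq[of "monom 1 m :: int poly" d] by (simp add: km monom_power)
      then obtain b where b: "X k = X m * b" by blast
      have "poly_at (X m) z \<noteq> 0" using prim m X_at by (simp add: primitive_root_of_unity_def)
      moreover have "poly_at (X m) z * poly_at b z = 0" using b z X_at by (metis poly_at_mult right_minus_eq)
      ultimately have "f dvd b" using div by simp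
      then have "poly_at b w = 0" using fw by (auto elim!: dvdE)
      then show False using no_double wm b by blast
    qed
    then show "w \<in> (\<lambda>j. z ^ j) ` totatives k" using j by (auto simp: totatives_def)
  qed
  have "rsquarefree ?f"
    unfolding rsquarefree_roots
  proof (intro allI notI)
    fix a assume a: "poly ?f a = 0 \<and> poly (pderiv ?f) a = 0"
    have "poly_at (X k) a = 0" "poly_at (pderiv (X k)) a = 0"
      unfolding g using a by (simp_all add: pderiv_mult map_poly_pderiv_of_int)
    then have "a ^ k = 1" "of_nat k * a ^ (k - 1) = 0" by (simp_all add: X_def pderiv_diff pderiv_monom)
    then show False using z(2) by (metis power_minus_mult mult_zero_left zero_neq_one less_le_trans
        zero_less_one mult_eq_0_iff of_nat_eq_0_iff not_one_le_zero)
  qed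
  then have dec: "smult (lead_coeff ?f) (\<Prod>w | poly ?f w = 0. [:- w, 1:]) = ?f"
    by (rule complex_poly_decompose_rsquarefree)
  have f0: "?f \<noteq> 0" using f by (auto simp: map_poly_eq_0_iff)
  have "degree f = degree ?f" by (rule degree_map_poly[symmetric]) simp
  also have "\<dots> = degree (\<Prod>w | poly ?f w = 0. [:- w, 1:])"
    using dec f0 by (metis degree_smult_eq leading_coeff_0_iff)
  also have "\<dots> = card {w. poly ?f w = 0}"
    by (subst degree_prod_sum_eq) auto
  also have "\<dots> \<le> card ((\<lambda>j. z ^ j) ` totatives k)" by (intro card_mono roots) auto
  also have "\<dots> \<le> totient k" unfolding totient_def by (rule card_image_le) simp
  finally have "degree f \<le> totient k" .
  then show ?thesis using f div[of f] by auto
qed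

lemma power_basis_independent:
  assumes "primitive_root_of_unity k z" "(\<Sum>i<totient k. of_int (c i) * z ^ i) = 0" "i < totient k"
  shows "c i = 0"
proof -
  define h where "h = (\<Sum>i<totient k. monom (c i) i)"
  have cf: "coeff h i = (if i < totient k then c i else 0)" for i
    by (simp add: h_def coeff_sum coeff_monom)
  have "poly_at h z = 0" using assms(2) by (simp add: h_def)
  then have "h \<noteq> 0 \<Longrightarrow> totient k \<le> degree h" using cyclotomic_degree_le assms(1) by blast
  moreover have "degree h < totient k" if "h \<noteq> 0" using cf that
    by (metis leading_coeff_neq_0)
  ultimately have "h = 0" by force
  then show ?thesis using cf[of i] assms(3) by simp
qed

lemma power_basis_spans:
  assumes "primitive_root_of_unity k z"
  shows "\<exists>c. z ^ j = (\<Sum>i<totient k. of_int (c i) * z ^ i)"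
proof -
  obtain f where f: "lead_coeff f = 1" "degree f \<le> totient k" "poly_at f z = 0"
    using cyclotomic_polynomial_exists[OF assms] by blast
  obtain q r where r: "monom 1 j = f * q + r" "r = 0 \<or> degree r < degree f"
    using monic_div[OF f(1)] by blast
  have "poly_at (monom 1 j) z = poly_at (f * q + r) z" using r(1) by simp
  then have "z ^ j = poly_at r z" using f(3) by simp
  also have "r = (\<Sum>i<totient k. monom (coeff r i) i)"
  proof (rule poly_eqI)
    fix i
    have "coeff r i = 0" if "i \<ge> totient k" using r(2) f(2) that by (auto intro: coeff_eq_0)
    then show "coeff r i = coeff (\<Sum>i<totient k. monom (coeff r i) i) i"
      by (auto simp: coeff_sum coeff_monom not_less)
  qed
  also have "poly_at \<dots> z = (\<Sum>i<totient k. of_int (coeff r i) * z ^ i)" by simp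
  finally show ?thesis by (rule exI[of _ "coeff r"])
qed

section \<open>Additive energy of the roots of unity\<close>

definition exponent_value :: "nat \<Rightarrow> complex \<Rightarrow> (nat \<Rightarrow>\<^sub>0 int) \<Rightarrow> complex" where
  "exponent_value k z a = (\<Sum>i=1..totient k. of_int (Poly_Mapping.lookup a i) * z ^ (i - 1))"

lemma cyclo_exponents_eq:
  "cyclo_exponents k z =
     {a. Poly_Mapping.keys a \<subseteq> {1..totient k} \<and> exponent_value k z a ^ k = 1}"
  by (simp add: cyclo_exponents_def exponent_value_def)

lemma exponent_value_add: "exponent_value k z (a + b) = exponent_value k z a + exponent_value k z b"
  by (simp add: exponent_value_def lookup_add algebra_simps sum.distrib)

lemma exponent_value_diff: "exponent_value k z (a - b) = exponent_value k z a - exponent_value k z b"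
  by (simp add: exponent_value_def lookup_minus algebra_simps sum_subtractf)

lemma exponent_value_shift:
  "exponent_value k z a = (\<Sum>i<totient k. of_int (Poly_Mapping.lookup a (Suc i)) * z ^ i)"
  unfolding exponent_value_def
  by (rule sum.reindex_bij_witness[of _ Suc "\<lambda>i. i - 1"]) auto

lemma exponent_value_eq_0:
  assumes "primitive_root_of_unity k z" "Poly_Mapping.keys a \<subseteq> {1..totient k}"
    "exponent_value k z a = 0"
  shows "a = 0"
proof (rule poly_mapping_eqI)
  fix i
  show "Poly_Mapping.lookup a i = Poly_Mapping.lookup 0 i"
  proof (cases "i \<in> {1..totient k}")
    case True
    then have "Poly_Mapping.lookup a (Suc (i - 1)) = 0"
      using power_basis_independent[OF assms(1), of "\<lambda>i. Poly_Mapping.lookup a (Suc i)" "i - 1"]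
        assms(3) by (auto simp: exponent_value_shift)
    then show ?thesis using True by simp
  next
    case False
    then show ?thesis using assms(2) by (auto simp: in_keys_iff)
  qed
qed

text \<open>Equations between exponent vectors can therefore be counted among the roots of unity.\<close>

lemma exponent_value_bij:
  assumes "primitive_root_of_unity k z"
  shows "bij_betw (exponent_value k z) (cyclo_exponents k z) {w. w ^ k = 1}"
  unfolding bij_betw_def
proof
  show "inj_on (exponent_value k z) (cyclo_exponents k z)"
  proof (rule inj_onI)
    fix a b assume ab: "a \<in> cyclo_exponents k z" "b \<in> cyclo_exponents k z"
      "exponent_value k z a = exponent_value k z b"
    have "Poly_Mapping.keys (a - b) \<subseteq> {1..totient k}"
      using keys_diff[of a b] ab by (auto simp: cyclo_exponents_eq)
    then have "a - b = 0"
      using exponent_value_eq_0[OF assms, of "a - b"] ab(3) by (simp add: exponent_value_diff)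
    then show "a = b" by simp
  qed
  show "exponent_value k z ` cyclo_exponents k z = {w. w ^ k = 1}"
  proof (intro equalityI subsetI)
    fix w assume "w \<in> {w::complex. w ^ k = 1}"
    then obtain j where j: "w = z ^ j" using primitive_root_powers[OF assms] by auto
    obtain c where c: "z ^ j = (\<Sum>i<totient k. of_int (c i) * z ^ i)"
      using power_basis_spans[OF assms] by blast
    define g where "g = (\<lambda>i. if i \<in> {1..totient k} then c (i - 1) else 0)"
    define a where "a = Poly_Mapping.Abs_poly_mapping g"
    have "finite {i. g i \<noteq> 0}" by (rule finite_subset[of _ "{1..totient k}"]) (auto simp: g_def)
    then have a: "Poly_Mapping.lookup a = g" unfolding a_def by (rule lookup_Abs_poly_mapping)
    have "Poly_Mapping.keys a \<subseteq> {1..totient k}" by (auto simp: in_keys_iff a g_def split: if_splits)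
    moreover have "exponent_value k z a = w"
      unfolding exponent_value_shift j c by (rule sum.cong) (auto simp: a g_def)
    ultimately show "w \<in> exponent_value k z ` cyclo_exponents k z"
      using \<open>w \<in> _\<close> by (auto simp: cyclo_exponents_eq)
  qed (auto simp: cyclo_exponents_eq)
qed

lemma cyclo_exponents_finite:
  assumes "primitive_root_of_unity k z"
  shows "finite (cyclo_exponents k z)" "card (cyclo_exponents k z) = k"
proof -
  have k: "k > 0" using assms by (auto simp: primitive_root_of_unity_def)
  show "card (cyclo_exponents k z) = k"
    using bij_betw_same_card[OF exponent_value_bij[OF assms]] card_roots_unity_eq[OF k] by simp
  then show "finite (cyclo_exponents k z)" using k by (intro card_ge_0_finite) simp
qed

text \<open>Conjugation inverts numbers of modulus one, so a nonzero sum of two of them determines their product, and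
with it the quadratic polynomial whose zeros they are.\<close>

lemma unit_sum_unique:
  fixes a b c d :: complex
  assumes "cmod a = 1" "cmod b = 1" "cmod c = 1" "cmod d = 1" "a + b = c + d" "a + b \<noteq> 0"
  shows "c = a \<and> d = b \<or> c = b \<and> d = a"
proof -
  have inv: "cnj x = 1 / x" "x \<noteq> 0" if "cmod x = 1" for x
    using that complex_norm_square[of x] by (auto simp: divide_simps mult.commute)
  have "cnj a + cnj b = cnj c + cnj d" using assms(5) by (metis complex_cnj_add)
  then have "(a + b) / (a * b) = (c + d) / (c * d)"
    using inv assms by (simp add: field_simps)
  then have ab: "a * b = c * d" using assms inv(2) by (simp add: divide_simps)
  have "(c - a) * (c - b) = c * c - (a + b) * c + a * b" by (simp add: algebra_simps)
  also have "\<dots> = 0" unfolding ab assms(5) by (simp add: algebra_simps)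
  finally have "c = a \<or> c = b" by simp
  then show ?thesis using assms(5) by auto
qed

text \<open>Two families of solutions are trivial; the third, \<open>a + b = 0 = c + d\<close>, requires that \<open>- 1\<close> be a \<open>k\<close>-th root
of unity.\<close>

lemma roots_of_unity_energy:
  assumes k: "k > 0"
  defines "U \<equiv> {w::complex. w ^ k = 1}"
  shows "card {(a, b, c, d). a \<in> U \<and> b \<in> U \<and> c \<in> U \<and> d \<in> U \<and> a + b = c + d}
    \<le> (if odd k then 2 else 3) * k ^ 2"
proof -
  have U: "finite U" "card U = k" using k finite_roots_unity[of k] card_roots_unity_eq[of k] by (auto simp: U_def)
  have nU: "cmod w = 1" if "w \<in> U" for w using that k unfolding U_def
    using power_eq_1_iff[of w k] by auto
  let ?E = "{(a, b, c, d). a \<in> U \<and> b \<in> U \<and> c \<in> U \<and> d \<in> U \<and> a + b = c + d}"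
  define A where "A = (\<lambda>(a, b). (a, b, a, b)) ` (U \<times> U)"
  define B where "B = (\<lambda>(a, b). (a, b, b, a)) ` (U \<times> U)"
  define C where "C = (if odd k then {} else (\<lambda>(a, c). (a, - a, c, - c)) ` (U \<times> U))"
  have "?E \<subseteq> A \<union> B \<union> C"
  proof
    fix x assume "x \<in> ?E"
    then obtain a b c d where x: "x = (a, b, c, d)" "a \<in> U" "b \<in> U" "c \<in> U" "d \<in> U" "a + b = c + d"
      by auto
    show "x \<in> A \<union> B \<union> C"
    proof (cases "a + b = 0")
      case True
      then have bd: "b = - a" "d = - c" using x(6) by (simp_all add: eq_neg_iff_add_eq_0 add.commute)
      then have "even k" using x(2,3) power_minus_odd[of k a] by (auto simp: U_def)
      then show ?thesis using x bd by (auto simp: C_def)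
    next
      case False
      then have "c = a \<and> d = b \<or> c = b \<and> d = a" using unit_sum_unique[of a b c d] x nU by auto
      then show ?thesis using x by (auto simp: A_def B_def)
    qed
  qed
  moreover have fin: "finite A" "finite B" "finite C" using U by (auto simp: A_def B_def C_def)
  ultimately have "card ?E \<le> card (A \<union> B \<union> C)" by (intro card_mono) auto
  also have "\<dots> \<le> card A + card B + card C"
    by (meson add_mono_thms_linordered_semiring(1) card_Un_le le_refl order_trans)
  finally have "card ?E \<le> card A + card B + card C" .
  moreover have "card A \<le> k ^ 2" "card B \<le> k ^ 2" "card C \<le> (if odd k then 0 else k ^ 2)"
    using U card_image_le[OF finite_cartesian_product[OF U(1) U(1)]]
    by (auto simp: A_def B_def C_def card_cartesian_product power2_eq_square)
  ultimately show ?thesis by (auto split: if_splits)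
qed

lemma cyclo_exponents_energy:
  assumes "primitive_root_of_unity k z"
  defines "A \<equiv> cyclo_exponents k z"
  shows "card {(a, b, c, d). a \<in> A \<and> b \<in> A \<and> c \<in> A \<and> d \<in> A \<and> a + b = c + d}
    \<le> (if odd k then 2 else 3) * k ^ 2"
proof -
  have k: "k > 0" using assms(1) by (auto simp: primitive_root_of_unity_def)
  let ?v = "exponent_value k z"
  let ?U = "{w::complex. w ^ k = 1}"
  let ?f = "\<lambda>(a, b, c, d). (?v a, ?v b, ?v c, ?v d)"
  have inj: "inj_on ?v A" and img: "?v ` A = ?U"
    using exponent_value_bij[OF assms(1)] by (auto simp: bij_betw_def A_def)
  have fU: "finite ?U" using k by (simp add: finite_roots_unity)
  show ?thesis
  proof (rule order_trans[OF card_inj_on_le[of ?f _ "{(a, b, c, d). a \<in> ?U \<and> b \<in> ?U \<and> c \<in> ?U \<and> d \<in> ?U \<and> a + b = c + d}"]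
      roots_of_unity_energy[OF k]])
    show "inj_on ?f {(a, b, c, d). a \<in> A \<and> b \<in> A \<and> c \<in> A \<and> d \<in> A \<and> a + b = c + d}"
      using inj by (auto simp: inj_on_def)
    show "?f ` {(a, b, c, d). a \<in> A \<and> b \<in> A \<and> c \<in> A \<and> d \<in> A \<and> a + b = c + d}
       \<subseteq> {(a, b, c, d). a \<in> ?U \<and> b \<in> ?U \<and> c \<in> ?U \<and> d \<in> ?U \<and> a + b = c + d}"
      using img by (auto simp: A_def cyclo_exponents_eq) (metis exponent_value_add)
    show "finite {(a, b, c, d). a \<in> ?U \<and> b \<in> ?U \<and> c \<in> ?U \<and> d \<in> ?U \<and> a + b = c + d}"
      by (rule finite_subset[of _ "?U \<times> ?U \<times> ?U \<times> ?U"]) (use fU in auto)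
  qed
qed

section \<open>Haar measure on the circle\<close>

lemma borel_measurable_cis [measurable]: "cis \<in> borel_measurable borel"
  by (intro borel_measurable_continuous_onI continuous_intros)

lemma space_circle [simp]: "space circle_haar = sphere 0 1"
  by (simp add: circle_haar_def space_restrict_space)

lemma sets_circle [measurable_cong]: "sets circle_haar = sets (restrict_space borel (sphere 0 1))"
  by (simp add: circle_haar_def)

lemma measurable_circle:
  assumes "f \<in> measurable borel M"
  shows "f \<in> measurable circle_haar M"
  using measurable_restrict_space1[OF assms, of "sphere 0 1"]
  by (simp add: measurable_cong_sets[OF sets_circle refl])

lemma measurable_cis_circle: "cis \<in> measurable (uniform_measure lborel S) (restrict_space borel (sphere 0 1))"
  by (rule measurable_restrict_space2) auto

lemma nn_integral_circle:
  assumes [measurable]: "f \<in> borel_measurable borel"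
  shows "(\<integral>\<^sup>+z. f z \<partial>circle_haar) = (\<integral>\<^sup>+t\<in>{0..2*pi}. f (cis t) \<partial>lborel) / ennreal (2 * pi)"
proof -
  have "(\<integral>\<^sup>+z. f z \<partial>circle_haar) = (\<integral>\<^sup>+t. f (cis t) \<partial>uniform_measure lborel {0..2*pi})"
    unfolding circle_haar_def
    by (rule nn_integral_distr) (auto intro!: measurable_cis_circle measurable_restrict_space1)
  also have "\<dots> = (\<integral>\<^sup>+t. f (cis t) * indicator {0..2*pi} t \<partial>lborel) / emeasure lborel {0..2*pi}"
    by (rule nn_integral_uniform_measure) auto
  finally show ?thesis by simp
qed

lemma prob_space_circle: "prob_space circle_haar"
proof -
  have "prob_space (uniform_measure lborel {0..2*pi})"
    by (rule prob_space_uniform_measure) auto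
  then show ?thesis unfolding circle_haar_def
    by (rule prob_space.prob_space_distr) (auto intro!: measurable_cis_circle)
qed

lemma nn_integral_period_shift:
  fixes g :: "real \<Rightarrow> ennreal"
  assumes [measurable]: "g \<in> borel_measurable borel"
  shows "(\<integral>\<^sup>+t\<in>{a..b}. g (t + s) \<partial>lborel) = (\<integral>\<^sup>+t\<in>{a+s..b+s}. g t \<partial>lborel)"
  by (subst (2) nn_integral_real_affine[where c = 1 and t = s])
    (auto intro!: nn_integral_cong simp: add.commute split: split_indicator)

lemma nn_integral_split_at:
  fixes g :: "real \<Rightarrow> ennreal"
  assumes [measurable]: "g \<in> borel_measurable borel" and "a \<le> b" "b \<le> c"
  shows "(\<integral>\<^sup>+t\<in>{a..c}. g t \<partial>lborel) = (\<integral>\<^sup>+t\<in>{a..b}. g t \<partial>lborel) + (\<integral>\<^sup>+t\<in>{b..c}. g t \<partial>lborel)"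
proof -
  have "(\<integral>\<^sup>+t\<in>{a..c}. g t \<partial>lborel)
      = (\<integral>\<^sup>+t. g t * indicator {a..b} t + g t * indicator {b..c} t \<partial>lborel)"
    using assms by (intro nn_integral_cong_AE AE_I[where N = "{b}"]) (auto split: split_indicator_asm)
  then show ?thesis by (simp add: nn_integral_add)
qed

lemma nn_integral_circle_minus:
  assumes [measurable]: "f \<in> borel_measurable borel"
  shows "(\<integral>\<^sup>+z. f (- z) \<partial>circle_haar) = (\<integral>\<^sup>+z. f z \<partial>circle_haar)"
proof -
  define g where "g = (\<lambda>t. f (cis t))"
  have gm [measurable]: "g \<in> borel_measurable borel" unfolding g_def by measurable
  have per: "g (t + 2 * pi) = g t" for t by (simp add: g_def cis.code)
  have m: "f (- cis t) = g (t + pi)" for t by (simp add: g_def flip: cis_mult)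
  have "(\<integral>\<^sup>+t\<in>{0..2*pi}. f (- cis t) \<partial>lborel) = (\<integral>\<^sup>+t\<in>{0+pi..2*pi+pi}. g t \<partial>lborel)"
    unfolding m by (rule nn_integral_period_shift) auto
  also have "\<dots> = (\<integral>\<^sup>+t\<in>{pi..2*pi}. g t \<partial>lborel) + (\<integral>\<^sup>+t\<in>{2*pi..2*pi+pi}. g t \<partial>lborel)"
    using nn_integral_split_at[of g pi "2*pi" "2*pi+pi"] by simp
  also have "(\<integral>\<^sup>+t\<in>{2*pi..2*pi+pi}. g t \<partial>lborel) = (\<integral>\<^sup>+t\<in>{0..pi}. g t \<partial>lborel)"
    using nn_integral_period_shift[OF gm, where a = 0 and b = pi and s = "2*pi"] unfolding per
    by (simp add: add.commute)
  also have "(\<integral>\<^sup>+t\<in>{pi..2*pi}. g t \<partial>lborel) + (\<integral>\<^sup>+t\<in>{0..pi}. g t \<partial>lborel)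
     = (\<integral>\<^sup>+t\<in>{0..2*pi}. g t \<partial>lborel)"
    by (subst add.commute, rule nn_integral_split_at[symmetric]) auto
  finally show ?thesis
    by (subst (1 2) nn_integral_circle) (auto simp: g_def)
qed

text \<open>Squaring doubles the angle, so the image runs through the circle twice at double speed.\<close>

lemma nn_integral_circle_square:
  assumes [measurable]: "f \<in> borel_measurable borel"
  shows "(\<integral>\<^sup>+z. f (z ^ 2) \<partial>circle_haar) = (\<integral>\<^sup>+z. f z \<partial>circle_haar)"
proof -
  define g where "g = (\<lambda>t. f (cis t))"
  have gm [measurable]: "g \<in> borel_measurable borel" unfolding g_def by measurable
  have per: "g (t + 2 * pi) = g t" for t by (simp add: g_def cis.code)
  have m: "f (cis t ^ 2) = g (2 * t)" for t using Complex.DeMoivre[of t 2] by (simp add: g_def)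
  let ?I = "\<integral>\<^sup>+t\<in>{0..2*pi}. g t \<partial>lborel"
  have "2 * (\<integral>\<^sup>+t\<in>{0..2*pi}. f (cis t ^ 2) \<partial>lborel) = (\<integral>\<^sup>+t\<in>{0..4*pi}. g t \<partial>lborel)"
    unfolding m by (subst (2) nn_integral_real_affine[where c = 2 and t = 0])
      (auto intro!: nn_integral_cong arg_cong[where f = "\<lambda>x. 2 * x"] simp: add.commute split: split_indicator)
  also have "\<dots> = ?I + (\<integral>\<^sup>+t\<in>{2*pi..4*pi}. g t \<partial>lborel)"
    by (simp add: nn_integral_split_at[of g 0 "2*pi" "4*pi"])
  also have "(\<integral>\<^sup>+t\<in>{2*pi..4*pi}. g t \<partial>lborel) = ?I"
    using nn_integral_period_shift[OF gm, where a = 0 and b = "2*pi" and s = "2*pi"] unfolding per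
    by simp
  also have "?I + ?I = 2 * ?I" by (rule mult_2[symmetric])
  finally have "(\<integral>\<^sup>+t\<in>{0..2*pi}. f (cis t ^ 2) \<partial>lborel) = ?I"
    by (subst (asm) ennreal_mult_cancel_left) simp
  then show ?thesis
    by (subst (1 2) nn_integral_circle) (auto simp: g_def)
qed

text \<open>Equality of the image measures carries an invariance from nonnegative functions over to all integrands,
vector-valued ones included.\<close>

lemma distr_circle_eqI:
  assumes T: "T \<in> measurable borel (borel :: complex measure)"
    and inv: "\<And>f :: complex \<Rightarrow> ennreal. f \<in> borel_measurable borel \<Longrightarrow>
      (\<integral>\<^sup>+z. f (T z) \<partial>circle_haar) = (\<integral>\<^sup>+z. f z \<partial>circle_haar)"
  shows "distr circle_haar borel T = distr circle_haar borel (\<lambda>z. z)"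
proof (rule measure_eqI)
  fix A assume "A \<in> sets (distr circle_haar borel T)"
  then have A: "A \<in> sets borel" by simp
  have m: "S \<in> measurable circle_haar borel \<Longrightarrow> emeasure (distr circle_haar borel S) A = (\<integral>\<^sup>+z. indicator A (S z) \<partial>circle_haar)" for S
    using A by (subst nn_integral_distr[symmetric, of S circle_haar borel "indicator A"]) auto
  show "emeasure (distr circle_haar borel T) A = emeasure (distr circle_haar borel (\<lambda>z. z)) A"
    using inv[of "indicator A"] A T by (simp add: m measurable_circle)
qed simp

lemma
  fixes f :: "complex \<Rightarrow> 'b :: {banach, second_countable_topology}"
  assumes f: "f \<in> borel_measurable borel"
  shows integral_circle_minus: "(\<integral>z. f (- z) \<partial>circle_haar) = (\<integral>z. f z \<partial>circle_haar)"
    and integral_circle_square: "(\<integral>z. f (z ^ 2) \<partial>circle_haar) = (\<integral>z. f z \<partial>circle_haar)"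
    and integrable_circle_minus: "integrable circle_haar (\<lambda>z. f (- z)) \<longleftrightarrow> integrable circle_haar f"
    and integrable_circle_square: "integrable circle_haar (\<lambda>z. f (z ^ 2)) \<longleftrightarrow> integrable circle_haar f"
proof -
  have d: "distr circle_haar borel (\<lambda>z. - z) = distr circle_haar borel (\<lambda>z. z)"
    "distr circle_haar borel (\<lambda>z. z ^ 2) = distr circle_haar borel (\<lambda>z. z)"
    by (rule distr_circle_eqI; simp add: nn_integral_circle_minus nn_integral_circle_square)+
  have m: "(\<lambda>z. - z) \<in> measurable circle_haar borel" "(\<lambda>z. z ^ 2) \<in> measurable circle_haar borel"
    "(\<lambda>z. z) \<in> measurable circle_haar borel"
    by (auto intro!: measurable_circle)
  show "(\<integral>z. f (- z) \<partial>circle_haar) = (\<integral>z. f z \<partial>circle_haar)"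
    using integral_distr[OF m(1) f] integral_distr[OF m(3) f] d by simp
  show "(\<integral>z. f (z ^ 2) \<partial>circle_haar) = (\<integral>z. f z \<partial>circle_haar)"
    using integral_distr[OF m(2) f] integral_distr[OF m(3) f] d by simp
  show "integrable circle_haar (\<lambda>z. f (- z)) \<longleftrightarrow> integrable circle_haar f"
    using integrable_distr_eq[OF m(1) f] integrable_distr_eq[OF m(3) f] d by simp
  show "integrable circle_haar (\<lambda>z. f (z ^ 2)) \<longleftrightarrow> integrable circle_haar f"
    using integrable_distr_eq[OF m(2) f] integrable_distr_eq[OF m(3) f] d by simp
qed

lemma borel_measurable_powi [measurable]: "(\<lambda>z::complex. z powi n) \<in> borel_measurable borel"
proof (cases "n \<ge> 0")
  case True
  then have "(\<lambda>z::complex. z powi n) = (\<lambda>z. z ^ nat n)" by (simp add: power_int_def)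
  then show ?thesis by simp
next
  case False
  then have "(\<lambda>z::complex. z powi n) = (\<lambda>z. inverse z ^ nat (- n))" by (simp add: power_int_def)
  then show ?thesis by simp
qed

lemma cmod_powi_circle: "cmod z = 1 \<Longrightarrow> cmod (z powi n) = 1"
  by (simp add: norm_power_int)

lemma integrable_circle_bounded:
  fixes f :: "complex \<Rightarrow> 'b :: {banach, second_countable_topology}"
  assumes "f \<in> borel_measurable borel" "\<And>z. cmod z = 1 \<Longrightarrow> norm (f z) \<le> B"
  shows "integrable circle_haar f"
proof -
  interpret prob_space circle_haar by (rule prob_space_circle)
  show ?thesis using assms
    by (intro integrable_const_bound[where B = B]) (auto intro!: measurable_circle)
qed

text \<open>Odd powers change sign under \<open>z \<mapsto> - z\<close>; a nonzero even power has the same integral as the power with half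
the exponent, by \<open>z \<mapsto> z\<^sup>2\<close>.\<close>

lemma integral_circle_powi:
  "(\<integral>z. z powi n \<partial>circle_haar) = (if n = 0 then 1 else 0)"
proof (induction "nat \<bar>n\<bar>" arbitrary: n rule: less_induct)
  case less
  interpret prob_space circle_haar by (rule prob_space_circle)
  consider "n = 0" | "odd n" | "even n" "n \<noteq> 0" by blast
  then show ?case
  proof cases
    case 1
    then show ?thesis using prob_space by simp
  next
    case 2
    have "(\<integral>z. z powi n \<partial>circle_haar) = (\<integral>z. (- z) powi n \<partial>circle_haar)"
      by (rule integral_circle_minus[symmetric]) measurable
    also have "\<dots> = - (\<integral>z. z powi n \<partial>circle_haar)"
      using 2 by (simp add: power_int_minus_left)
    finally show ?thesis using 2 by auto
  next
    case 3
    then obtain m where m: "n = 2 * m" by (auto elim: evenE)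
    have "(\<integral>z. z powi n \<partial>circle_haar) = (\<integral>z. (z ^ 2) powi m \<partial>circle_haar)"
      by (simp add: m power_int_mult)
    also have "\<dots> = (\<integral>z. z powi m \<partial>circle_haar)"
      by (rule integral_circle_square) measurable
    also have "\<dots> = 0" using less.hyps[of m] 3 m by auto
    finally show ?thesis using 3 by simp
  qed
qed

text \<open>The preimage of \<open>w\<^sup>2\<close> under squaring consists of \<open>w\<close> and \<open>- w\<close>, which have the same mass.  So passing from a
point to its square doubles the mass, and the total mass is finite.\<close>

lemma circle_singleton_null: "cmod w = 1 \<Longrightarrow> measure circle_haar {w} = 0"
proof -
  interpret prob_space circle_haar by (rule prob_space_circle)
  have s: "{w} \<in> sets circle_haar" if "cmod w = 1" for w
    using that by (auto simp: sets_circle sets_restrict_space_iff)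
  have i: "integrable circle_haar (indicat_real {w})" for w
    by (rule integrable_circle_bounded[where B = 1]) (auto split: split_indicator)
  have e: "measure circle_haar {w} = (\<integral>z. indicat_real {w} z \<partial>circle_haar)" if "cmod w = 1" for w
    using s[OF that] that by (simp add: Int_absorb2)
  have half: "measure circle_haar {w} = measure circle_haar {w ^ 2} / 2" if w: "cmod w = 1" for w
  proof -
    have w2: "cmod (w ^ 2) = 1" using w by (simp add: norm_power)
    have "measure circle_haar {w ^ 2} = (\<integral>z. indicat_real {w ^ 2} (z ^ 2) \<partial>circle_haar)"
      unfolding e[OF w2] by (rule integral_circle_square[symmetric]) simp
    also have "\<dots> = (\<integral>z. indicat_real {w} z + indicat_real {w} (- z) \<partial>circle_haar)"
      using w by (intro Bochner_Integration.integral_cong refl)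
        (auto simp: power2_eq_iff indicator_def)
    also have "\<dots> = (\<integral>z. indicat_real {w} z \<partial>circle_haar) + (\<integral>z. indicat_real {w} (- z) \<partial>circle_haar)"
      by (rule Bochner_Integration.integral_add)
        (auto intro!: i simp: integrable_circle_minus[of "indicat_real {w}"])
    also have "(\<integral>z. indicat_real {w} (- z) \<partial>circle_haar) = (\<integral>z. indicat_real {w} z \<partial>circle_haar)"
      using integral_circle_minus[of "indicat_real {w}"] by simp
    finally show ?thesis unfolding e[OF w] by simp
  qed
  have "measure circle_haar {w} \<le> (1/2) ^ m" if "cmod w = 1" for m w
    using that
  proof (induction m arbitrary: w)
    case (Suc m)
    then show ?case using Suc.IH[of "w ^ 2"] half[of w] by (simp add: norm_power)
  qed simp
  moreover have "(\<lambda>m. (1/2) ^ m :: real) \<longlonglongrightarrow> 0" by (rule LIMSEQ_realpow_zero) auto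
  ultimately show "cmod w = 1 \<Longrightarrow> measure circle_haar {w} = 0"
    using LIMSEQ_le_const[of "\<lambda>m. (1/2) ^ m :: real" 0 "measure circle_haar {w}"]
    by (metis antisym measure_nonneg)
qed

lemma AE_circle_neq: "AE z in circle_haar. z \<noteq> w"
proof (cases "cmod w = 1")
  case True
  interpret prob_space circle_haar by (rule prob_space_circle)
  show ?thesis using True
    by (intro AE_I[where N = "{w}"])
      (auto simp: emeasure_eq_measure circle_singleton_null sets_circle sets_restrict_space_iff)
qed (auto intro!: AE_I2)

section \<open>Jensen's formula for a linear polynomial\<close>

text \<open>By the parallelogram identity the squares of the two distances add up to at least 2.\<close>

lemma parallelogram_max:
  assumes z: "cmod z = 1"
  shows "1 \<le> cmod (z - w) \<or> 1 \<le> cmod (z + w)"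
proof (rule ccontr)
  assume "\<not> ?thesis"
  then have "cmod (z - w) ^ 2 + cmod (z + w) ^ 2 < 1 + 1"
    by (intro add_strict_mono power_less_one_iff[THEN iffD2]) auto
  moreover have "cmod (z - w) ^ 2 + cmod (z + w) ^ 2 = 2 * cmod z ^ 2 + 2 * cmod w ^ 2"
    unfolding cmod_power2 by (simp add: power2_eq_square algebra_simps)
  ultimately show False using z by simp
qed

text \<open>The logarithm of the distance from \<open>w\<close> to a point of the circle, shifted so as to be nonpositive for \<open>w\<close> in
the unit disc, and cut off below so as to be integrable.\<close>

definition clipped_log :: "nat \<Rightarrow> complex \<Rightarrow> complex \<Rightarrow> real" where
  "clipped_log n w z = max (- real n) (ln (cmod (z - w)) - ln 2)"

lemma ln_dist_le:
  assumes "cmod w \<le> 1" "cmod z = 1"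
  shows "ln (cmod (z - w)) \<le> ln 2"
proof (cases "z = w")
  case False
  have "cmod (z - w) \<le> 2" using norm_triangle_ineq4[of z w] assms by simp
  then show ?thesis using False by (simp add: ln_le_cancel_iff)
qed simp

lemma borel_measurable_clipped_log: "clipped_log n w \<in> borel_measurable borel"
  unfolding clipped_log_def by measurable

lemma integrable_clipped_log:
  assumes "cmod w \<le> 1"
  shows "integrable circle_haar (clipped_log n w)"
  using ln_dist_le[OF assms]
  by (intro integrable_circle_bounded[where B = "real n"] borel_measurable_clipped_log)
    (force simp: clipped_log_def)

text \<open>This is \<open>ln |z\<^sup>2 - w\<^sup>2| = ln |z - w| + ln |z + w|\<close>, kept as an inequality under clipping.  It survives because
at most one of the two distances is less than 1, so the other summand is at least \<open>- ln 2\<close>.\<close>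

lemma clipped_log_square_le:
  assumes w: "cmod w \<le> 1" and z: "cmod z = 1"
  shows "clipped_log n (w ^ 2) (z ^ 2) - ln 2 \<le> clipped_log n w z + clipped_log n w (- z)"
proof -
  define u where "u = ln (cmod (z - w)) - ln 2"
  define v where "v = ln (cmod (z + w)) - ln 2"
  have neg: "cmod (- z - w) = cmod (z + w)" by (subst norm_minus_cancel[symmetric]) (simp del: norm_minus_cancel)
  have uv: "u \<le> 0" "v \<le> 0" using ln_dist_le[OF w z] ln_dist_le[of "- w" z] w z by (auto simp: u_def v_def)
  have big: "u \<ge> - ln 2 \<or> v \<ge> - ln 2"
    using parallelogram_max[OF z, of w] by (auto simp: u_def v_def)
  have "clipped_log n w z = max (- real n) u" "clipped_log n w (- z) = max (- real n) v"
    by (simp_all add: clipped_log_def u_def v_def neg)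
  moreover have "clipped_log n (w ^ 2) (z ^ 2) - ln 2 \<le> max (- real n) u + max (- real n) v"
  proof (cases "z = w \<or> z = - w")
    \<comment> \<open>By the convention \<open>ln 0 = 0\<close> the vanishing distance counts as 1; the other distance is 2.\<close>
    case True
    then have "z ^ 2 = w ^ 2" by auto
    then have "clipped_log n (w ^ 2) (z ^ 2) = max (- real n) (- ln 2)" by (simp add: clipped_log_def)
    moreover have "(u = - ln 2 \<and> v = 0) \<or> (v = - ln 2 \<and> u = 0)"
      using True
    proof
      assume "z = w"
      then have "cmod (z + w) = 2" using z by (simp add: norm_mult flip: mult_2)
      then show ?thesis using \<open>z = w\<close> by (simp add: u_def v_def)
    next
      assume *: "z = - w"
      then have "z - w = 2 * z" by simp
      then have "cmod (z - w) = cmod (2 * z)" by (simp only:)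
      then have "cmod (z - w) = 2" using z by (simp add: norm_mult)
      then show ?thesis using * by (simp add: u_def v_def)
    qed
    ultimately show ?thesis by auto
  next
    case False
    have "z ^ 2 - w ^ 2 = (z - w) * (z + w)" by (simp add: power2_eq_square algebra_simps)
    then have "ln (cmod (z ^ 2 - w ^ 2)) = ln (cmod (z - w)) + ln (cmod (z + w))"
      using False by (simp add: norm_mult ln_mult eq_neg_iff_add_eq_0)
    then have "clipped_log n (w ^ 2) (z ^ 2) = max (- real n) (u + v + ln 2)"
      by (simp add: clipped_log_def u_def v_def)
    then show ?thesis using uv big by (auto simp: max_def)
  qed
  ultimately show ?thesis by simp
qed

text \<open>The mean \<open>H w\<close> of the clipped logarithm satisfies \<open>H (w\<^sup>2) - ln 2 \<le> 2 * H w\<close>.  Iterating this from the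
trivial lower bound \<open>- n\<close> halves the gap to the fixed point \<open>- ln 2\<close> at every step, so that the
resulting bound is independent of \<open>n\<close>.\<close>

lemma integral_clipped_log_ge:
  assumes "cmod w \<le> 1"
  shows "- ln 2 \<le> (\<integral>z. clipped_log n w z \<partial>circle_haar)"
proof -
  interpret prob_space circle_haar by (rule prob_space_circle)
  let ?H = "\<lambda>w. \<integral>z. clipped_log n w z \<partial>circle_haar"
  have step: "?H (w ^ 2) - ln 2 \<le> 2 * ?H w" if w: "cmod w \<le> 1" for w
  proof -
    have w2: "cmod (w ^ 2) \<le> 1" using w by (simp add: norm_power power_le_one)
    note m = borel_measurable_clipped_log and i = integrable_clipped_log
    have i2: "integrable circle_haar (\<lambda>z. clipped_log n (w ^ 2) (z ^ 2))"
      by (subst integrable_circle_square) (auto intro: m i w2)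
    have im: "integrable circle_haar (\<lambda>z. clipped_log n w (- z))"
      by (subst integrable_circle_minus) (auto intro: m i w)
    have "?H (w ^ 2) - ln 2 = (\<integral>z. clipped_log n (w ^ 2) (z ^ 2) - ln 2 \<partial>circle_haar)"
      using i2 integral_circle_square[OF m[of n "w ^ 2"]] prob_space by simp
    also have "\<dots> \<le> (\<integral>z. clipped_log n w z + clipped_log n w (- z) \<partial>circle_haar)"
      using clipped_log_square_le[OF w] i2 im i[OF w] by (intro integral_mono) auto
    also have "\<dots> = 2 * ?H w"
      using integral_circle_minus[OF m[of n w]] i[OF w] im by simp
    finally show ?thesis .
  qed
  have "?H w \<ge> - ln 2 - real n * (1/2) ^ m" if "cmod w \<le> 1" for m w
    using that
  proof (induction m arbitrary: w)
    case 0
    have "(\<integral>z. - real n \<partial>circle_haar) \<le> ?H w"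
      using 0 by (intro integral_mono integrable_clipped_log) (auto simp: clipped_log_def)
    then have "- real n \<le> ?H w" using prob_space by simp
    moreover have "0 \<le> ln (2::real)" by simp
    ultimately show ?case unfolding power_0 by linarith
  next
    case (Suc m)
    have "cmod (w ^ 2) \<le> 1" using Suc.prems by (simp add: norm_power power_le_one)
    from Suc.IH[OF this] step[OF Suc.prems] show ?case by simp
  qed
  moreover have "(\<lambda>m. - ln 2 - real n * (1/2) ^ m :: real) \<longlonglongrightarrow> - ln 2 - real n * 0"
    by (intro tendsto_intros LIMSEQ_realpow_zero) auto
  ultimately show ?thesis using assms LIMSEQ_le_const2[of _ "- ln 2 - real n * 0" "?H w"] by auto
qed

text \<open>Monotone convergence removes the cutoff, since the clipped means are bounded uniformly in \<open>n\<close>.\<close>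

lemma log_dist_integrable_unit_disc:
  assumes w: "cmod w \<le> 1"
  shows "integrable circle_haar (\<lambda>z. ln (cmod (z - w)))"
    and "- ln 2 \<le> (\<integral>z. ln (cmod (z - w)) - ln 2 \<partial>circle_haar)"
proof -
  interpret prob_space circle_haar by (rule prob_space_circle)
  define g where "g = (\<lambda>z. ln 2 - ln (cmod (z - w)))"
  have g0: "0 \<le> g z" if "cmod z = 1" for z using ln_dist_le[OF w that] by (simp add: g_def)
  have gm: "g \<in> borel_measurable circle_haar" unfolding g_def by (intro measurable_circle) measurable
  have cl: "clipped_log n w z = - min (real n) (g z)" for n z
    by (auto simp: clipped_log_def g_def max_def min_def)
  have nn: "(\<integral>\<^sup>+z. ennreal (g z) \<partial>circle_haar) = (SUP n. \<integral>\<^sup>+z. ennreal (min (real n) (g z)) \<partial>circle_haar)"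
  proof (subst nn_integral_monotone_convergence_SUP[symmetric])
    show "incseq (\<lambda>n z. ennreal (min (real n) (g z)))"
      by (auto simp: incseq_def le_fun_def intro!: ennreal_leI)
    show "(\<lambda>z. ennreal (min (real n) (g z))) \<in> borel_measurable circle_haar" for n
      using gm by measurable
    show "(\<integral>\<^sup>+z. ennreal (g z) \<partial>circle_haar) = (\<integral>\<^sup>+z. (SUP n. ennreal (min (real n) (g z))) \<partial>circle_haar)"
    proof (rule nn_integral_cong)
      fix z
      obtain N where "g z \<le> real N" using real_arch_simple by blast
      then have "ennreal (g z) = ennreal (min (real N) (g z))" by (simp add: min_def)
      then show "ennreal (g z) = (SUP n. ennreal (min (real n) (g z)))"
        by (intro antisym SUP_least ennreal_leI) (auto intro!: SUP_upper2[of N])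
    qed
  qed
  also have "\<dots> \<le> ennreal (ln 2)"
  proof (rule SUP_least)
    fix n
    have "(\<integral>\<^sup>+z. ennreal (min (real n) (g z)) \<partial>circle_haar) = ennreal (\<integral>z. min (real n) (g z) \<partial>circle_haar)"
      using Bochner_Integration.integrable_minus[OF integrable_clipped_log[OF w, of n]] g0
      by (intro nn_integral_eq_integral) (auto simp: cl)
    also have "\<dots> \<le> ennreal (ln 2)"
      using integral_clipped_log_ge[OF w, of n] by (intro ennreal_leI) (simp add: cl)
    finally show "(\<integral>\<^sup>+z. ennreal (min (real n) (g z)) \<partial>circle_haar) \<le> ennreal (ln 2)" .
  qed
  finally have le: "(\<integral>\<^sup>+z. ennreal (g z) \<partial>circle_haar) \<le> ennreal (ln 2)" .
  have gi: "integrable circle_haar g"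
    using gm g0 le by (intro integrableI_nonneg) (auto intro: le_less_trans)
  have "integrable circle_haar (\<lambda>z. ln 2 - g z)" using gi by simp
  then show "integrable circle_haar (\<lambda>z. ln (cmod (z - w)))" by (simp add: g_def)
  have "ennreal (\<integral>z. g z \<partial>circle_haar) \<le> ennreal (ln 2)"
    using nn_integral_eq_integral[OF gi AE_I2] g0 le by simp
  then have "(\<integral>z. g z \<partial>circle_haar) \<le> ln 2" by simp
  then have "- ln 2 \<le> (\<integral>z. - g z \<partial>circle_haar)" by simp
  then show "- ln 2 \<le> (\<integral>z. ln (cmod (z - w)) - ln 2 \<partial>circle_haar)" by (simp add: g_def)
qed

text \<open>The mean \<open>I w\<close> satisfies \<open>I (w\<^sup>2) = 2 * I w\<close> and is bounded by \<open>ln 2\<close> on the unit disc, which is closed under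
squaring; hence it is zero.  The argument covers the points \<open>w\<close> of the unit circle itself.\<close>

lemma log_dist_integral_unit_disc:
  assumes "cmod w \<le> 1"
  shows "(\<integral>z. ln (cmod (z - w)) \<partial>circle_haar) = 0"
proof -
  interpret prob_space circle_haar by (rule prob_space_circle)
  let ?I = "\<lambda>w. \<integral>z. ln (cmod (z - w)) \<partial>circle_haar"
  have m: "(\<lambda>z. ln (cmod (z - w))) \<in> borel_measurable borel" for w by measurable
  have dbl: "?I (w ^ 2) = 2 * ?I w" if w: "cmod w \<le> 1" for w
  proof -
    note i = log_dist_integrable_unit_disc(1)[OF w]
    have im: "integrable circle_haar (\<lambda>z. ln (cmod (- z - w)))"
      using integrable_circle_minus[OF m[of w]] i by simp
    have neg: "cmod (- z - w) = cmod (z + w)" for z by (subst norm_minus_cancel[symmetric]) (simp del: norm_minus_cancel)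
    have "?I (w ^ 2) = (\<integral>z. ln (cmod (z ^ 2 - w ^ 2)) \<partial>circle_haar)"
      using integral_circle_square[OF m[of "w ^ 2"]] by simp
    also have "\<dots> = (\<integral>z. ln (cmod (z - w)) + ln (cmod (- z - w)) \<partial>circle_haar)"
    proof (rule integral_cong_AE)
      show "AE z in circle_haar. ln (cmod (z ^ 2 - w ^ 2)) = ln (cmod (z - w)) + ln (cmod (- z - w))"
        using AE_circle_neq[of w] AE_circle_neq[of "- w"]
      proof eventually_elim
        case (elim z)
        have "z ^ 2 - w ^ 2 = (z - w) * (z + w)" by (simp add: power2_eq_square algebra_simps)
        then show ?case using elim by (simp add: norm_mult ln_mult neg eq_neg_iff_add_eq_0)
      qed
    qed (intro measurable_circle; measurable)+
    also have "\<dots> = ?I w + (\<integral>z. ln (cmod (- z - w)) \<partial>circle_haar)"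
      by (rule Bochner_Integration.integral_add[OF i im])
    also have "(\<integral>z. ln (cmod (- z - w)) \<partial>circle_haar) = ?I w"
      by (rule integral_circle_minus[OF m])
    finally show ?thesis by simp
  qed
  have bound: "\<bar>?I w\<bar> \<le> ln 2" if w: "cmod w \<le> 1" for w
  proof -
    note i = log_dist_integrable_unit_disc[OF w]
    have "?I w \<le> (\<integral>z. ln 2 \<partial>circle_haar)"
      using ln_dist_le[OF w] i(1) by (intro integral_mono) auto
    moreover have "(\<integral>z. ln (cmod (z - w)) - ln 2 \<partial>circle_haar) = ?I w - ln 2"
      using i(1) prob_space by simp
    ultimately show ?thesis using i(2) prob_space by simp
  qed
  have "\<bar>?I w\<bar> \<le> ln 2 * (1/2) ^ m" if "cmod w \<le> 1" for m w
    using that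
  proof (induction m arbitrary: w)
    case (Suc m)
    have "cmod (w ^ 2) \<le> 1" using Suc.prems by (simp add: norm_power power_le_one)
    from Suc.IH[OF this] dbl[OF Suc.prems] show ?case by simp
  qed (use bound in auto)
  moreover have "(\<lambda>m. ln 2 * (1/2) ^ m :: real) \<longlonglongrightarrow> ln 2 * 0"
    by (intro tendsto_intros LIMSEQ_realpow_zero) auto
  ultimately have "\<bar>?I w\<bar> \<le> ln 2 * 0"
    using assms LIMSEQ_le_const[of _ "ln 2 * 0" "\<bar>?I w\<bar>"] by blast
  then show ?thesis by simp
qed

text \<open>Reflection in the unit circle sends a point outside the closed disc into the disc and scales its distances
to the points of the circle by a constant factor.\<close>

lemma cmod_diff_reflect:
  assumes "cmod z = 1" "w \<noteq> 0"
  shows "cmod (z - w) = cmod w * cmod (z - 1 / cnj w)"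
proof -
  have "cnj w * (z - 1 / cnj w) = - (z * cnj (z - w))"
    using assms complex_norm_square[of z] by (simp add: algebra_simps)
  then have "cmod (cnj w * (z - 1 / cnj w)) = cmod (z * cnj (z - w))" by (metis norm_minus_cancel)
  then show ?thesis using assms by (simp add: norm_mult del: complex_cnj_diff)
qed

text \<open>The bound for the mean of the absolute value is what Fubini's theorem needs when \<open>w\<close> varies in a bounded set.\<close>

lemma jensen_linear:
  shows integrable_log_dist: "integrable circle_haar (\<lambda>z. ln (cmod (z - w)))"
    and integral_log_dist: "(\<integral>z. ln (cmod (z - w)) \<partial>circle_haar) = max 0 (ln (cmod w))"
    and integral_abs_log_dist: "(\<integral>z. \<bar>ln (cmod (z - w))\<bar> \<partial>circle_haar) \<le> 2 * ln 2 + max 0 (ln (cmod w))"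
proof -
  interpret prob_space circle_haar by (rule prob_space_circle)
  have disc: "(\<integral>z. \<bar>ln (cmod (z - w))\<bar> \<partial>circle_haar) \<le> 2 * ln 2" if w: "cmod w \<le> 1" for w
  proof -
    note i = log_dist_integrable_unit_disc(1)[OF w]
    have "(\<integral>z. \<bar>ln (cmod (z - w))\<bar> \<partial>circle_haar) \<le> (\<integral>z. 2 * ln 2 - ln (cmod (z - w)) \<partial>circle_haar)"
      using i ln_dist_le[OF w] by (intro integral_mono) (auto simp: abs_le_iff)
    also have "\<dots> = 2 * ln 2" using i log_dist_integral_unit_disc[OF w] prob_space by simp
    finally show ?thesis .
  qed
  have all: "integrable circle_haar (\<lambda>z. ln (cmod (z - w))) \<and>
    (\<integral>z. ln (cmod (z - w)) \<partial>circle_haar) = max 0 (ln (cmod w)) \<and>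
    (\<integral>z. \<bar>ln (cmod (z - w))\<bar> \<partial>circle_haar) \<le> 2 * ln 2 + max 0 (ln (cmod w))"
  proof (cases "cmod w \<le> 1")
    case True
    then have "ln (cmod w) \<le> 0" by (cases "w = 0") auto
    then show ?thesis using disc[OF True] log_dist_integrable_unit_disc(1)[OF True]
        log_dist_integral_unit_disc[OF True] by simp
  next
    case False
    define v where "v = 1 / cnj w"
    have v: "cmod v \<le> 1" using False by (simp add: v_def norm_divide divide_le_eq)
    note i = log_dist_integrable_unit_disc(1)[OF v]
    have w: "ln (cmod w) > 0" using False by (intro ln_gt_zero) simp
    have eq: "AE z in circle_haar. ln (cmod (z - w)) = ln (cmod w) + ln (cmod (z - v))"
      using AE_circle_neq[of v] AE_space
    proof eventually_elim
      case (elim z)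
      have "w \<noteq> 0" using False by auto
      then have "cmod (z - w) = cmod w * cmod (z - v)"
        using elim cmod_diff_reflect[of z w] by (simp add: v_def)
      then show ?case using elim \<open>w \<noteq> 0\<close> by (simp add: ln_mult)
    qed
    have m: "(\<lambda>z. ln (cmod (z - w))) \<in> borel_measurable circle_haar" for w
      by (intro measurable_circle) measurable
    have s: "integrable circle_haar (\<lambda>z. ln (cmod w) + ln (cmod (z - v)))" using i by simp
    have 1: "integrable circle_haar (\<lambda>z. ln (cmod (z - w)))"
      using s integrable_cong_AE[OF m _ eq] by simp
    have 2: "(\<integral>z. ln (cmod (z - w)) \<partial>circle_haar) = ln (cmod w)"
      using integral_cong_AE[OF m _ eq] s i log_dist_integral_unit_disc[OF v] prob_space by simp
    have "(\<integral>z. \<bar>ln (cmod (z - w))\<bar> \<partial>circle_haar) \<le> (\<integral>z. ln (cmod w) + \<bar>ln (cmod (z - v))\<bar> \<partial>circle_haar)"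
      using 1 i eq w by (intro integral_mono_AE) (auto elim!: eventually_mono)
    also have "\<dots> \<le> ln (cmod w) + 2 * ln 2" using i disc[OF v] prob_space by simp
    finally show ?thesis using 1 2 w by simp
  qed
  then show "integrable circle_haar (\<lambda>z. ln (cmod (z - w)))"
    "(\<integral>z. ln (cmod (z - w)) \<partial>circle_haar) = max 0 (ln (cmod w))"
    "(\<integral>z. \<bar>ln (cmod (z - w))\<bar> \<partial>circle_haar) \<le> 2 * ln 2 + max 0 (ln (cmod w))" by auto
qed

section \<open>Monomials and moments on the torus\<close>

definition monomial_value :: "(nat \<Rightarrow>\<^sub>0 int) \<Rightarrow> (nat \<Rightarrow> complex) \<Rightarrow> complex" where
  "monomial_value a x = (\<Prod>i\<in>Poly_Mapping.keys a. x i powi Poly_Mapping.lookup a i)"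

lemma monomial_value_superset:
  assumes "finite I" "Poly_Mapping.keys a \<subseteq> I"
  shows "monomial_value a x = (\<Prod>i\<in>I. x i powi Poly_Mapping.lookup a i)"
  unfolding monomial_value_def using assms
  by (intro prod.mono_neutral_left) (auto simp: in_keys_iff)

lemma laurent_eval_superset:
  assumes "finite S" "Poly_Mapping.keys f \<subseteq> S"
  shows "laurent_eval f x = (\<Sum>a\<in>S. Poly_Mapping.lookup f a * monomial_value a x)"
  unfolding laurent_eval_def monomial_value_def[symmetric] using assms
  by (intro sum.mono_neutral_left) (auto simp: in_keys_iff)

lemma laurent_eval_add: "laurent_eval (f + g) x = laurent_eval f x + laurent_eval g x"
proof -
  let ?S = "Poly_Mapping.keys f \<union> Poly_Mapping.keys g"
  have "Poly_Mapping.keys (f + g) \<subseteq> ?S" by (rule keys_add)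
  then show ?thesis
    by (simp add: laurent_eval_superset[of ?S] lookup_add algebra_simps sum.distrib)
qed

lemma laurent_eval_single: "laurent_eval (Poly_Mapping.single a c) x = c * monomial_value a x"
  by (simp add: laurent_eval_superset[of "{a}"])

lemma laurent_eval_monom: "laurent_eval (laurent_monom a) x = monomial_value a x"
  by (simp add: laurent_monom_def laurent_eval_single)

lemma laurent_eval_sum: "laurent_eval (sum f A) x = (\<Sum>a\<in>A. laurent_eval (f a) x)"
proof (induction A rule: infinite_finite_induct)
  case (insert a A)
  then show ?case by (simp add: laurent_eval_add)
qed (simp_all add: laurent_eval_def)

lemma laurent_eval_diff: "laurent_eval (f - g) x = laurent_eval f x - laurent_eval g x"
  using laurent_eval_add[of "f - g" g x] by simp

lemma laurent_eval_var: "laurent_eval (laurent_var i) x = x i"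
  by (simp add: laurent_var_def laurent_eval_monom monomial_value_def)

lemma laurent_eval_1: "laurent_eval 1 x = 1"
  using laurent_eval_single[of 0 1 x] by (simp add: monomial_value_def)

lemma laurent_eval_var_cubed: "laurent_eval (laurent_var i ^ 3) x = x i ^ 3"
proof -
  have "laurent_var i ^ 3 = Poly_Mapping.single (Poly_Mapping.single i 3) 1"
    by (simp add: laurent_var_def laurent_monom_def power3_eq_cube mult_single flip: single_add)
  then show ?thesis by (simp add: laurent_eval_single monomial_value_def)
qed

abbreviation torus :: "nat set \<Rightarrow> (nat \<Rightarrow> complex) measure" where
  "torus I \<equiv> \<Pi>\<^sub>M i\<in>I. circle_haar"

lemma prob_space_torus: "prob_space (torus I)"
  by (intro prob_space_PiM prob_space_circle)

lemma torus_coord: "x \<in> space (torus I) \<Longrightarrow> i \<in> I \<Longrightarrow> cmod (x i) = 1"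
  by (auto simp: space_PiM PiE_def Pi_def)

lemma product_sigma_finite_circle: "product_sigma_finite (\<lambda>i::nat. circle_haar)"
proof -
  interpret prob_space circle_haar by (rule prob_space_circle)
  show ?thesis by unfold_locales
qed

lemma measurable_torus_coord:
  assumes "i \<in> I"
  shows "(\<lambda>x. x i) \<in> borel_measurable (torus I)"
  using measurable_compose[OF measurable_component_singleton[OF assms] measurable_circle[of "\<lambda>z. z" borel]]
  by simp

lemma borel_measurable_monomial_value:
  assumes "Poly_Mapping.keys a \<subseteq> I"
  shows "monomial_value a \<in> borel_measurable (torus I)"
  unfolding monomial_value_def[abs_def]
  using assms by (intro borel_measurable_prod measurable_compose[OF measurable_torus_coord borel_measurable_powi]) auto

lemma norm_monomial_value:
  assumes "x \<in> space (torus I)" "Poly_Mapping.keys a \<subseteq> I"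
  shows "cmod (monomial_value a x) = 1"
  unfolding monomial_value_def prod_norm[symmetric]
  using assms torus_coord[OF assms(1)] by (intro prod.neutral) (auto simp: norm_power_int)

lemma monomial_value_add:
  assumes "x \<in> space (torus I)" "Poly_Mapping.keys a \<subseteq> I" "Poly_Mapping.keys b \<subseteq> I" "finite I"
  shows "monomial_value (a + b) x = monomial_value a x * monomial_value b x"
proof -
  have "Poly_Mapping.keys (a + b) \<subseteq> I" using keys_add[of a b] assms by auto
  moreover have "x i \<noteq> 0" if "i \<in> I" for i using torus_coord[OF assms(1) that] by auto
  ultimately show ?thesis using assms
    by (simp add: monomial_value_superset[of I] lookup_add power_int_add prod.distrib)
qed

lemma monomial_value_uminus:
  assumes "x \<in> space (torus I)" "Poly_Mapping.keys a \<subseteq> I"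
  shows "monomial_value (- a) x = cnj (monomial_value a x)"
proof -
  have "x i powi (- n) = cnj (x i powi n)" if "i \<in> I" for i n
  proof -
    have "cmod (x i powi n) = 1" using torus_coord[OF assms(1) that] by (rule cmod_powi_circle)
    then have "inverse (x i powi n) = cnj (x i powi n)"
      by (metis inverse_eq_divide complex_div_cnj mult_1 div_by_1 of_real_1 power_one)
    then show ?thesis by (simp add: power_int_minus)
  qed
  then show ?thesis using assms(2) by (auto simp: monomial_value_def intro!: prod.cong)
qed

lemma integral_monomial_value:
  assumes I: "finite I" "Poly_Mapping.keys a \<subseteq> I"
  shows "integrable (torus I) (monomial_value a)"
    and "(\<integral>x. monomial_value a x \<partial>torus I) = (if a = 0 then 1 else 0)"
proof -
  interpret product_sigma_finite "\<lambda>i::nat. circle_haar" by (rule product_sigma_finite_circle)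
  have i: "integrable circle_haar (\<lambda>z. z powi n)" for n
    by (rule integrable_circle_bounded[where B = 1]) (auto simp: norm_power_int)
  have eq: "monomial_value a = (\<lambda>x. \<Prod>i\<in>I. x i powi Poly_Mapping.lookup a i)"
    using monomial_value_superset[OF I] by blast
  show "integrable (torus I) (monomial_value a)"
    unfolding eq by (rule product_integrable_prod[OF I(1) i])
  have "(\<integral>x. monomial_value a x \<partial>torus I) = (\<Prod>i\<in>I. if Poly_Mapping.lookup a i = 0 then 1 else 0)"
    unfolding eq by (subst product_integral_prod[OF I(1) i]) (simp add: integral_circle_powi)
  also have "\<dots> = (if a = 0 then 1 else 0)"
  proof (cases "a = 0")
    case False
    then obtain j where "j \<in> Poly_Mapping.keys a" by (metis keys_eq_empty ex_in_conv)
    then show ?thesis using I False by (auto simp: in_keys_iff intro!: prod_zero)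
  qed simp
  finally show "(\<integral>x. monomial_value a x \<partial>torus I) = (if a = 0 then 1 else 0)" .
qed

lemma integral_sum_monomial_value:
  assumes I: "finite I" and J: "finite J" "\<And>j. j \<in> J \<Longrightarrow> Poly_Mapping.keys (\<phi> j) \<subseteq> I"
  shows "integrable (torus I) (\<lambda>x. \<Sum>j\<in>J. monomial_value (\<phi> j) x)"
    and "(\<integral>x. (\<Sum>j\<in>J. monomial_value (\<phi> j) x) \<partial>torus I) = of_nat (card {j \<in> J. \<phi> j = 0})"
proof -
  show "integrable (torus I) (\<lambda>x. \<Sum>j\<in>J. monomial_value (\<phi> j) x)"
    using integral_monomial_value(1)[OF I] J by (intro Bochner_Integration.integrable_sum) auto
  have "(\<integral>x. (\<Sum>j\<in>J. monomial_value (\<phi> j) x) \<partial>torus I) = (\<Sum>j\<in>J. if \<phi> j = 0 then 1 else 0)"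
    using integral_monomial_value[OF I] J by (subst Bochner_Integration.integral_sum) auto
  also have "\<dots> = of_nat (card {j \<in> J. \<phi> j = 0})"
    using J(1) by (simp flip: sum.inter_filter)
  finally show "(\<integral>x. (\<Sum>j\<in>J. monomial_value (\<phi> j) x) \<partial>torus I) = of_nat (card {j \<in> J. \<phi> j = 0})" .
qed

text \<open>Only the monomials with exponent 0 contribute to the integral, so it counts them.\<close>

lemma integral_real_monomial_sum:
  fixes f :: "(nat \<Rightarrow> complex) \<Rightarrow> real"
  assumes I: "finite I" and J: "finite J" "\<And>j. j \<in> J \<Longrightarrow> Poly_Mapping.keys (\<phi> j) \<subseteq> I"
    and f: "\<And>x. x \<in> space (torus I) \<Longrightarrow> complex_of_real (f x) = (\<Sum>j\<in>J. monomial_value (\<phi> j) x)"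
  shows "integrable (torus I) f" and "(\<integral>x. f x \<partial>torus I) = real (card {j \<in> J. \<phi> j = 0})"
proof -
  note s = integral_sum_monomial_value[OF I J]
  have "integrable (torus I) (\<lambda>x. complex_of_real (f x))"
    using s(1) by (subst Bochner_Integration.integrable_cong[OF refl f]) auto
  then show "integrable (torus I) f" by (simp only: complex_of_real_integrable_eq)
  have "complex_of_real (\<integral>x. f x \<partial>torus I) = of_nat (card {j \<in> J. \<phi> j = 0})"
    unfolding integral_complex_of_real[symmetric]
    using s(2) by (subst Bochner_Integration.integral_cong[OF refl f]) auto
  then show "(\<integral>x. f x \<partial>torus I) = real (card {j \<in> J. \<phi> j = 0})"
    by (metis of_real_eq_iff of_real_of_nat_eq)
qed

definition exponential_sum :: "(nat \<Rightarrow>\<^sub>0 int) set \<Rightarrow> (nat \<Rightarrow> complex) \<Rightarrow> complex" where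
  "exponential_sum A x = (\<Sum>a\<in>A. monomial_value a x)"

lemma monomial_value_diff:
  assumes "x \<in> space (torus I)" "Poly_Mapping.keys a \<subseteq> I" "Poly_Mapping.keys b \<subseteq> I" "finite I"
  shows "monomial_value (a - b) x = monomial_value a x * cnj (monomial_value b x)"
  using monomial_value_add[of x I a "- b"] monomial_value_uminus[of x I b] assms by simp

lemma second_moment:
  assumes I: "finite I" and A: "finite A" "\<And>a. a \<in> A \<Longrightarrow> Poly_Mapping.keys a \<subseteq> I"
  shows "integrable (torus I) (\<lambda>x. cmod (exponential_sum A x) ^ 2)"
    and "(\<integral>x. cmod (exponential_sum A x) ^ 2 \<partial>torus I) = real (card A)"
proof -
  define \<phi> where "\<phi> = (\<lambda>(a :: nat \<Rightarrow>\<^sub>0 int, b). a - b)"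
  have k: "Poly_Mapping.keys (\<phi> j) \<subseteq> I" if "j \<in> A \<times> A" for j
    using keys_diff[of "fst j" "snd j"] A(2) that by (cases j) (fastforce simp: \<phi>_def)
  have eq: "complex_of_real (cmod (exponential_sum A x) ^ 2) = (\<Sum>j\<in>A \<times> A. monomial_value (\<phi> j) x)"
    if x: "x \<in> space (torus I)" for x
  proof -
    have "complex_of_real (cmod (exponential_sum A x) ^ 2) = exponential_sum A x * cnj (exponential_sum A x)"
      by (simp only: complex_norm_square)
    also have "\<dots> = (\<Sum>(a, b)\<in>A \<times> A. monomial_value a x * cnj (monomial_value b x))"
      by (simp add: exponential_sum_def sum_product sum.cartesian_product)
    also have "\<dots> = (\<Sum>j\<in>A \<times> A. monomial_value (\<phi> j) x)"
      using A by (intro sum.cong) (auto simp: \<phi>_def monomial_value_diff[OF x _ _ I])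
    finally show ?thesis .
  qed
  note s = integral_real_monomial_sum[OF I finite_cartesian_product[OF A(1) A(1)] k eq]
  show "integrable (torus I) (\<lambda>x. cmod (exponential_sum A x) ^ 2)" using s(1) by simp
  have "{j \<in> A \<times> A. \<phi> j = 0} = (\<lambda>a. (a, a)) ` A" by (auto simp: \<phi>_def)
  then have "card {j \<in> A \<times> A. \<phi> j = 0} = card A" by (simp add: card_image inj_on_def)
  then show "(\<integral>x. cmod (exponential_sum A x) ^ 2 \<partial>torus I) = real (card A)" using s(2) by simp
qed

text \<open>Write \<open>|F|\<^sup>4\<close> as \<open>F\<^sup>2\<close> times its conjugate and expand: the exponents are the differences
\<open>(a + b) - (c + d)\<close>.\<close>

lemma fourth_moment:
  assumes I: "finite I" and A: "finite A" "\<And>a. a \<in> A \<Longrightarrow> Poly_Mapping.keys a \<subseteq> I"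
  shows "integrable (torus I) (\<lambda>x. cmod (exponential_sum A x) ^ 4)"
    and "(\<integral>x. cmod (exponential_sum A x) ^ 4 \<partial>torus I) =
      real (card {(a, b, c, d). a \<in> A \<and> b \<in> A \<and> c \<in> A \<and> d \<in> A \<and> a + b = c + d})"
proof -
  define \<phi> where "\<phi> = (\<lambda>((a :: nat \<Rightarrow>\<^sub>0 int, b), (c, d)). (a + b) - (c + d))"
  let ?J = "(A \<times> A) \<times> (A \<times> A)"
  have k2: "Poly_Mapping.keys (a + b) \<subseteq> I" if "a \<in> A" "b \<in> A" for a b
    using keys_add[of a b] A(2) that by blast
  have k: "Poly_Mapping.keys (\<phi> j) \<subseteq> I" if "j \<in> ?J" for j
  proof -
    obtain a b c d where j: "j = ((a, b), (c, d))" by (metis surj_pair)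
    show ?thesis using keys_diff[of "a + b" "c + d"] k2[of a b] k2[of c d] that by (auto simp: \<phi>_def j)
  qed
  have eq: "complex_of_real (cmod (exponential_sum A x) ^ 4) = (\<Sum>j\<in>?J. monomial_value (\<phi> j) x)"
    if x: "x \<in> space (torus I)" for x
  proof -
    let ?m = "\<lambda>a. monomial_value a x"
    have "exponential_sum A x * exponential_sum A x = (\<Sum>(a, b)\<in>A \<times> A. ?m a * ?m b)"
      by (simp add: exponential_sum_def sum_product sum.cartesian_product)
    also have "\<dots> = (\<Sum>(a, b)\<in>A \<times> A. ?m (a + b))"
      using A by (intro sum.cong) (auto simp: monomial_value_add[OF x _ _ I])
    finally have sq: "exponential_sum A x * exponential_sum A x = (\<Sum>p\<in>A \<times> A. ?m (fst p + snd p))"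
      by (simp add: case_prod_beta')
    have "complex_of_real (cmod (exponential_sum A x) ^ 4)
        = complex_of_real (cmod (exponential_sum A x * exponential_sum A x) ^ 2)"
      by (simp add: norm_mult power_mult_distrib flip: power_add)
    also have "\<dots> = (exponential_sum A x * exponential_sum A x) * cnj (exponential_sum A x * exponential_sum A x)"
      by (simp only: complex_norm_square)
    also have "\<dots> = (\<Sum>(p, q)\<in>?J. ?m (fst p + snd p) * cnj (?m (fst q + snd q)))"
      unfolding sq by (simp add: sum_product sum.cartesian_product)
    also have "\<dots> = (\<Sum>j\<in>?J. ?m (\<phi> j))"
      using k2 by (intro sum.cong) (auto simp: \<phi>_def monomial_value_diff[OF x _ _ I])
    finally show ?thesis .
  qed
  have fJ: "finite ?J" using A(1) by simp
  note s = integral_real_monomial_sum[OF I fJ k eq]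
  show "integrable (torus I) (\<lambda>x. cmod (exponential_sum A x) ^ 4)" using s(1) by simp
  have "{(a, b, c, d). a \<in> A \<and> b \<in> A \<and> c \<in> A \<and> d \<in> A \<and> a + b = c + d}
      = (\<lambda>((a, b), (c, d)). (a, b, c, d)) ` {j \<in> ?J. \<phi> j = 0}"
    by (force simp: \<phi>_def)
  then have "card {(a, b, c, d). a \<in> A \<and> b \<in> A \<and> c \<in> A \<and> d \<in> A \<and> a + b = c + d} = card {j \<in> ?J. \<phi> j = 0}"
    by (simp add: card_image inj_on_def split_def prod_eq_iff)
  then show "(\<integral>x. cmod (exponential_sum A x) ^ 4 \<partial>torus I) =
      real (card {(a, b, c, d). a \<in> A \<and> b \<in> A \<and> c \<in> A \<and> d \<in> A \<and> a + b = c + d})" using s(2) by simp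
qed

section \<open>Integrating out the variable of degree one\<close>

text \<open>Jensen's formula applied to the coordinate \<open>i\<close>, the other coordinates being fixed.  The integrand is
unbounded near the zeros of \<open>x i + H x\<close>; the bound on \<open>H\<close> makes it integrable, because the means of
\<open>|ln |y + w||\<close> over \<open>y\<close> are bounded uniformly for \<open>w\<close> in a bounded set.\<close>

lemma integral_log_new_coord:
  fixes H :: "(nat \<Rightarrow> complex) \<Rightarrow> complex"
  assumes I: "finite I" "i \<notin> I"
    and H: "H \<in> borel_measurable (torus I)" "H \<in> borel_measurable (torus (insert i I))"
    and indep: "\<And>x y. H (x(i := y)) = H x"
    and bound: "\<And>x. x \<in> space (torus I) \<Longrightarrow> cmod (H x) \<le> B"
  shows "(\<integral>x. ln (cmod (x i + H x)) \<partial>torus (insert i I)) = (\<integral>x. max 0 (ln (cmod (H x))) \<partial>torus I)"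
proof -
  interpret product_sigma_finite "\<lambda>i::nat. circle_haar" by (rule product_sigma_finite_circle)
  interpret T: prob_space "torus I" by (rule prob_space_torus)
  let ?f = "\<lambda>x. ln (cmod (x i + H x))"
  have inner: "ln (cmod (y + H x)) = ln (cmod (y - (- H x)))" for x y by simp
  have [measurable]: "(\<lambda>x. x i) \<in> borel_measurable (torus (insert i I))" by (rule measurable_torus_coord) simp
  note H[measurable]
  have f: "?f \<in> borel_measurable (torus (insert i I))" by measurable
  define C where "C = 2 * ln 2 + max 0 (ln (max 1 B))"
  have C: "(\<integral>\<^sup>+y. ennreal \<bar>ln (cmod (y + H x))\<bar> \<partial>circle_haar) \<le> ennreal C" if x: "x \<in> space (torus I)" for x
  proof -
    have "(\<integral>\<^sup>+y. ennreal \<bar>ln (cmod (y + H x))\<bar> \<partial>circle_haar)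
        = ennreal (\<integral>y. \<bar>ln (cmod (y + H x))\<bar> \<partial>circle_haar)"
      unfolding inner by (intro nn_integral_eq_integral integrable_abs integrable_log_dist) auto
    moreover have "(\<integral>y. \<bar>ln (cmod (y + H x))\<bar> \<partial>circle_haar) \<le> C"
    proof -
      have "(\<integral>y. \<bar>ln (cmod (y + H x))\<bar> \<partial>circle_haar) \<le> 2 * ln 2 + max 0 (ln (cmod (- H x)))"
        unfolding inner by (rule integral_abs_log_dist)
      moreover have "ln (cmod (- H x)) \<le> ln (max 1 B)"
        using bound[OF x] by (cases "H x = 0") auto
      then have "max 0 (ln (cmod (- H x))) \<le> max 0 (ln (max 1 B))" by (intro max.mono) auto
      ultimately show ?thesis unfolding C_def by linarith
    qed
    ultimately show ?thesis by (simp add: ennreal_leI)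
  qed
  have "(\<integral>\<^sup>+x. ennreal (norm (?f x)) \<partial>torus (insert i I))
      = (\<integral>\<^sup>+x. (\<integral>\<^sup>+y. ennreal \<bar>ln (cmod (y + H x))\<bar> \<partial>circle_haar) \<partial>torus I)"
    using f by (subst product_nn_integral_insert[OF I]) (auto simp: indep)
  also have "\<dots> \<le> (\<integral>\<^sup>+x. ennreal C \<partial>torus I)" by (intro nn_integral_mono C)
  also have "\<dots> < \<infinity>" by (simp add: T.emeasure_space_1)
  finally have "integrable (torus (insert i I)) ?f" using f by (simp add: integrable_iff_bounded)
  then have "(\<integral>x. ?f x \<partial>torus (insert i I)) = (\<integral>x. (\<integral>y. ln (cmod (y + H x)) \<partial>circle_haar) \<partial>torus I)"
    by (subst product_integral_insert[OF I]) (auto simp: indep)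
  also have "\<dots> = (\<integral>x. max 0 (ln (cmod (H x))) \<partial>torus I)"
    unfolding inner integral_log_dist by simp
  finally show ?thesis .
qed

lemma borel_measurable_exponential_sum:
  assumes "\<And>a. a \<in> A \<Longrightarrow> Poly_Mapping.keys a \<subseteq> I"
  shows "exponential_sum A \<in> borel_measurable (torus I)"
  unfolding exponential_sum_def[abs_def] using assms
  by (intro borel_measurable_sum borel_measurable_monomial_value) auto

lemma norm_exponential_sum_le:
  assumes "x \<in> space (torus I)" "\<And>a. a \<in> A \<Longrightarrow> Poly_Mapping.keys a \<subseteq> I"
  shows "cmod (exponential_sum A x) \<le> real (card A)"
proof -
  have "cmod (exponential_sum A x) \<le> (\<Sum>a\<in>A. cmod (monomial_value a x))"
    unfolding exponential_sum_def by (rule norm_sum)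
  also have "\<dots> = real (card A)" using norm_monomial_value[OF assms(1)] assms(2) by simp
  finally show ?thesis .
qed

lemma mahler_var_plus_exponential_sum:
  assumes A: "\<And>a. a \<in> A \<Longrightarrow> Poly_Mapping.keys a \<subseteq> {1..n}"
  shows "log_mahler_measure (n + 1) (laurent_var 0 + (\<Sum>a\<in>A. laurent_monom a))
       = (\<integral>x. max 0 (ln (cmod (exponential_sum A x))) \<partial>torus {1..n})"
proof -
  have I: "{..<n + 1} = insert 0 {1..n}" by auto
  have A': "Poly_Mapping.keys a \<subseteq> insert 0 {1..n}" if "a \<in> A" for a using A[OF that] by auto
  have "monomial_value a (x(0 := y)) = monomial_value a x" if "a \<in> A" for a x y
    unfolding monomial_value_def using A[OF that] by (intro prod.cong) auto
  then have indep: "exponential_sum A (x(0 := y)) = exponential_sum A x" for x y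
    by (simp add: exponential_sum_def)
  show ?thesis
    unfolding log_mahler_measure_def I laurent_eval_add laurent_eval_var laurent_eval_sum
      laurent_eval_monom exponential_sum_def[symmetric]
    by (rule integral_log_new_coord[where B = "real (card A)"])
      (use A A' in \<open>auto intro!: borel_measurable_exponential_sum norm_exponential_sum_le simp: indep\<close>)
qed

lemma cyclovariety_mahler_eq:
  "cyclovariety_mahler k z = (\<integral>x. max 0 (ln (cmod (exponential_sum (cyclo_exponents k z) x))) \<partial>torus {1..totient k})"
  unfolding cyclovariety_mahler_def cyclo_poly_def
  by (rule mahler_var_plus_exponential_sum) (auto simp: cyclo_exponents_def)

section \<open>A lower bound from two moments\<close>

lemma ln_2_ge: "69 / 100 \<le> ln (2 :: real)"
proof -
  \<comment> \<open>Equivalent to \<open>exp 69 \<le> 2\<^bsup>100\<^esup>\<close>.\<close>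
  have "exp (69 :: real) = exp 1 ^ 69" by (simp flip: exp_of_nat_mult)
  also have "\<dots> \<le> (272 / 100) ^ 69" using e_less_272 by (intro power_mono) auto
  also have "\<dots> \<le> 2 ^ 100" by (simp add: power_divide divide_le_eq)
  finally have "ln (exp (69 :: real)) \<le> ln (2 ^ 100)" by (subst ln_le_cancel_iff) auto
  then have "69 \<le> ln ((2 :: real) ^ 100)" by (simp only: ln_exp)
  also have "\<dots> = 100 * ln 2" by (subst ln_realpow) simp_all
  finally show ?thesis by simp
qed

text \<open>The quadratic polynomial \<open>A (t - 1) - B (t - 1)\<^sup>2\<close> with the coefficients \<open>A = hermite_slope c\<close> and
\<open>B = hermite_curv c\<close> is the Hermite interpolant of \<open>ln\<close> with a simple node at 1 and a double node at \<open>c\<close>.\<close>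

definition hermite_slope :: "real \<Rightarrow> real" where
  "hermite_slope c = 2 * ln c / (c - 1) - 1 / c"

definition hermite_curv :: "real \<Rightarrow> real" where
  "hermite_curv c = (ln c / (c - 1) - 1 / c) / (c - 1)"

text \<open>Below 1 the interpolant is nonpositive.  Above 1, the derivative of its difference from \<open>ln\<close> is
\<open>2 B (t - c) (t - r) / t\<close> with \<open>1 \<le> r \<le> c\<close>, so \<open>ln\<close> minus the interpolant rises from the value 0 at 1, then
falls to the value 0 at \<open>c\<close>, and rises again.\<close>

lemma hermite_le_log:
  assumes c: "c > 1" and t: "t \<ge> 0"
    and AB: "0 \<le> hermite_slope c" "0 \<le> hermite_curv c"
      "2 * hermite_curv c * c \<le> 1" "1 \<le> 2 * hermite_curv c * c ^ 2"
  shows "hermite_slope c * (t - 1) - hermite_curv c * (t - 1) ^ 2 \<le> max 0 (ln t)"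
proof (cases "t \<le> 1")
  case True
  then have "hermite_slope c * (t - 1) \<le> 0" using AB(1) by (simp add: mult_nonneg_nonpos)
  moreover have "0 \<le> hermite_curv c * (t - 1) ^ 2" using AB(2) by simp
  ultimately show ?thesis by linarith
next
  case False
  define A where "A = hermite_slope c"
  define B where "B = hermite_curv c"
  define g where "g = (\<lambda>t. ln t - A * (t - 1) + B * (t - 1) ^ 2)"
  define r where "r = 1 / (2 * B * c)"
  have B1: "B * (c - 1) = ln c / (c - 1) - 1 / c" using c by (simp add: B_def hermite_curv_def)
  then have A: "A = 1 / c + 2 * B * (c - 1)" by (simp add: A_def hermite_slope_def)
  have B: "B > 0" using AB(4) c unfolding B_def[symmetric]
    by (metis AB(2) B_def less_eq_real_def mult_zero_left mult_zero_right not_one_le_zero)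
  have g1: "g 1 = 0" by (simp add: g_def)
  have "A * (c - 1) = 2 * ln c - (c - 1) / c"
    using c by (simp add: A_def hermite_slope_def left_diff_distrib)
  moreover have "B * (c - 1) ^ 2 = (B * (c - 1)) * (c - 1)" by (simp add: power2_eq_square)
  then have "B * (c - 1) ^ 2 = ln c - (c - 1) / c"
    unfolding B1 using c by (simp add: left_diff_distrib)
  ultimately have gc: "g c = 0" by (simp add: g_def)
  have r: "1 \<le> r" "r \<le> c" using AB(3,4) B c unfolding B_def[symmetric]
    by (simp_all add: r_def divide_simps power2_eq_square mult_ac)
  have dg: "(g has_real_derivative (x - c) * (2 * B) * (x - r) / x) (at x)" if "x > 0" for x
  proof -
    have "(g has_real_derivative (1 / x - A + B * (2 * (x - 1)))) (at x)"
      unfolding g_def using that by (auto intro!: derivative_eq_intros)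
    moreover have "1 / x - A + B * (2 * (x - 1)) = (x - c) * (2 * B) * (x - r) / x"
      unfolding A r_def using that c B by (simp add: field_simps)
    ultimately show ?thesis by simp
  qed
  have up: "g a \<le> g b" if "a \<le> b" "0 < a" "\<And>x. a \<le> x \<Longrightarrow> x \<le> b \<Longrightarrow> 0 \<le> (x - c) * (x - r)" for a b
  proof (rule DERIV_nonneg_imp_nondecreasing[OF that(1)])
    fix x assume x: "a \<le> x" "x \<le> b"
    have "0 \<le> 2 * B * ((x - c) * (x - r)) / x" using mult_nonneg_nonneg[OF _ that(3)[OF x], of "2 * B"] that(2) B x
      by (intro divide_nonneg_pos) auto
    also have "\<dots> = (x - c) * (2 * B) * (x - r) / x" by simp
    finally show "\<exists>y. (g has_real_derivative y) (at x) \<and> 0 \<le> y" using dg[of x] x that by force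
  qed
  have dn: "g b \<le> g a" if "a \<le> b" "0 < a" "\<And>x. a \<le> x \<Longrightarrow> x \<le> b \<Longrightarrow> (x - c) * (x - r) \<le> 0" for a b
  proof (rule DERIV_nonpos_imp_nonincreasing[OF that(1)])
    fix x assume x: "a \<le> x" "x \<le> b"
    have "(x - c) * (2 * B) * (x - r) / x = 2 * B * ((x - c) * (x - r)) / x" by simp
    also have "\<dots> \<le> 0" using mult_nonneg_nonpos[OF _ that(3)[OF x], of "2 * B"] that(2) B x
      by (intro divide_nonpos_pos) auto
    finally show "\<exists>y. (g has_real_derivative y) (at x) \<and> y \<le> 0" using dg[of x] x that by force
  qed
  consider "t \<le> r" | "r \<le> t" "t \<le> c" | "c \<le> t" by linarith
  then have "0 \<le> g t"
  proof cases
    case 1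
    then have "g 1 \<le> g t" using False r by (intro up) (auto intro: mult_nonpos_nonpos)
    then show ?thesis using g1 by simp
  next
    case 2
    then have "g c \<le> g t" using r by (intro dn) (auto intro: mult_nonpos_nonneg)
    then show ?thesis using gc by simp
  next
    case 3
    then have "g c \<le> g t" using r c by (intro up) (auto intro: mult_nonneg_nonneg)
    then show ?thesis using gc by simp
  qed
  then have "A * (t - 1) - B * (t - 1) ^ 2 \<le> ln t" by (simp add: g_def)
  then show ?thesis by (simp add: A_def B_def)
qed

text \<open>The last inequality is the value of the interpolant for a variable with mean 3 and second moment 18: then
\<open>t - 1\<close> has mean 2 and second moment 13.  The node 8 is close to the best one and brings in only \<open>ln 2\<close>.\<close>

lemma hermite_8:
  shows "0 \<le> hermite_slope 8" "0 \<le> hermite_curv 8" "2 * hermite_curv 8 * 8 \<le> 1"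
    "1 \<le> 2 * hermite_curv 8 * 8 ^ 2" "58 / 100 \<le> 2 * hermite_slope 8 - 13 * hermite_curv 8"
proof -
  have "ln (8 :: real) = ln (2 ^ 3)" by simp
  then have l: "ln (8 :: real) = 3 * ln 2" by (simp only: ln_realpow of_nat_numeral)
  note b = ln_2_ge ln_2_less_1
  show "0 \<le> hermite_slope 8" "0 \<le> hermite_curv 8" "2 * hermite_curv 8 * 8 \<le> 1"
    "1 \<le> 2 * hermite_curv 8 * 8 ^ 2" "58 / 100 \<le> 2 * hermite_slope 8 - 13 * hermite_curv 8"
    using b unfolding hermite_slope_def hermite_curv_def l by (simp_all add: field_simps)
qed

text \<open>The corresponding node for mean 4 and second moment 48, where \<open>t - 1\<close> has mean 3 and second moment 41.\<close>

lemma hermite_16: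
  shows "0 \<le> hermite_slope 16" "0 \<le> hermite_curv 16" "2 * hermite_curv 16 * 16 \<le> 1"
    "1 \<le> 2 * hermite_curv 16 * 16 ^ 2" "58 / 100 \<le> 3 * hermite_slope 16 - 41 * hermite_curv 16"
proof -
  have "ln (16 :: real) = ln (2 ^ 4)" by simp
  then have l: "ln (16 :: real) = 4 * ln 2" by (simp only: ln_realpow of_nat_numeral)
  note b = ln_2_ge ln_2_less_1
  show "0 \<le> hermite_slope 16" "0 \<le> hermite_curv 16" "2 * hermite_curv 16 * 16 \<le> 1"
    "1 \<le> 2 * hermite_curv 16 * 16 ^ 2" "58 / 100 \<le> 3 * hermite_slope 16 - 41 * hermite_curv 16"
    using b unfolding hermite_slope_def hermite_curv_def l by (simp_all add: field_simps)
qed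

text \<open>Rescale \<open>|F|\<^sup>2\<close> to \<open>s = m |F|\<^sup>2 / card A\<close>, which has mean \<open>m\<close>, and whose second moment is at most \<open>e m\<^sup>2\<close>.  As
\<open>s \<le> |F|\<^sup>2\<close>, the interpolant at \<open>s\<close> is at most \<open>2 max 0 (ln |F|)\<close>.  Fixing \<open>m\<close> lets one node \<open>c\<close> serve for
sets \<open>A\<close> of every size.\<close>

lemma mean_log_ge_of_moments:
  assumes I: "finite I" and A: "finite A" "\<And>a. a \<in> A \<Longrightarrow> Poly_Mapping.keys a \<subseteq> I"
    and m: "0 < m" "m \<le> real (card A)"
    and E: "real (card {(a, b, c, d). a \<in> A \<and> b \<in> A \<and> c \<in> A \<and> d \<in> A \<and> a + b = c + d}) \<le> e * real (card A) ^ 2"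
    and c: "c > 1" "0 \<le> hermite_slope c" "0 \<le> hermite_curv c"
      "2 * hermite_curv c * c \<le> 1" "1 \<le> 2 * hermite_curv c * c ^ 2"
  shows "(hermite_slope c * (m - 1) - hermite_curv c * (e * m ^ 2 - 2 * m + 1)) / 2
    \<le> (\<integral>x. max 0 (ln (cmod (exponential_sum A x))) \<partial>torus I)"
proof -
  interpret T: prob_space "torus I" by (rule prob_space_torus)
  let ?k = "real (card A)"
  let ?F = "\<lambda>x. cmod (exponential_sum A x)"
  define s where "s = (\<lambda>x. m / ?k * ?F x ^ 2)"
  define P where "P = hermite_slope c"
  define Q where "Q = hermite_curv c"
  have k: "?k > 0" using m by linarith
  note m2 = second_moment[OF I A] and m4 = fourth_moment[OF I A]
  have s1: "integrable (torus I) s" "(\<integral>x. s x \<partial>torus I) = m"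
    using m2 k unfolding s_def by simp_all
  have s2_eq: "s x ^ 2 = (m / ?k) ^ 2 * ?F x ^ 4" for x
    unfolding s_def by (simp add: power_mult_distrib power_divide flip: power_mult)
  have s2: "integrable (torus I) (\<lambda>x. s x ^ 2)" "(\<integral>x. s x ^ 2 \<partial>torus I) \<le> e * m ^ 2"
  proof -
    show "integrable (torus I) (\<lambda>x. s x ^ 2)" unfolding s2_eq using m4 by simp
    have "(\<integral>x. s x ^ 2 \<partial>torus I) \<le> (m / ?k) ^ 2 * (e * ?k ^ 2)"
      unfolding s2_eq using m4 E by (simp add: mult_left_mono)
    also have "\<dots> = e * m ^ 2" using k by (simp add: power_divide)
    finally show "(\<integral>x. s x ^ 2 \<partial>torus I) \<le> e * m ^ 2" .
  qed
  have q_eq: "P * (s x - 1) - Q * (s x - 1) ^ 2 = (P + 2 * Q) * s x - Q * s x ^ 2 - (P + Q)" for x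
    by (simp add: power2_eq_square algebra_simps)
  have qi: "integrable (torus I) (\<lambda>x. P * (s x - 1) - Q * (s x - 1) ^ 2)"
    unfolding q_eq using s1 s2 by simp
  have "(\<integral>x. P * (s x - 1) - Q * (s x - 1) ^ 2 \<partial>torus I)
      = (P + 2 * Q) * m - Q * (\<integral>x. s x ^ 2 \<partial>torus I) - (P + Q)"
    unfolding q_eq using s1 s2 T.prob_space by simp
  also have "\<dots> \<ge> P * (m - 1) - Q * (e * m ^ 2 - 2 * m + 1)"
    using mult_left_mono[OF s2(2), of Q] c(3) by (simp add: Q_def algebra_simps)
  finally have lower: "P * (m - 1) - Q * (e * m ^ 2 - 2 * m + 1) \<le> (\<integral>x. P * (s x - 1) - Q * (s x - 1) ^ 2 \<partial>torus I)" .
  have F: "exponential_sum A \<in> borel_measurable (torus I)" using A(2) by (rule borel_measurable_exponential_sum)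
  have Fi: "integrable (torus I) (\<lambda>x. max 0 (ln (?F x)))"
  proof (rule T.integrable_const_bound[where B = "ln ?k"])
    show "AE x in torus I. norm (max 0 (ln (?F x))) \<le> ln ?k"
    proof (rule AE_I2)
      fix x assume "x \<in> space (torus I)"
      then have le: "?F x \<le> ?k" using A(2) by (rule norm_exponential_sum_le)
      have "1 \<le> ?k" using k by (simp add: Suc_le_eq)
      then show "norm (max 0 (ln (?F x))) \<le> ln ?k" using le by (cases "?F x = 0") auto
    qed
    show "(\<lambda>x. max 0 (ln (?F x))) \<in> borel_measurable (torus I)" using F by measurable
  qed
  have "(\<integral>x. P * (s x - 1) - Q * (s x - 1) ^ 2 \<partial>torus I) \<le> (\<integral>x. 2 * max 0 (ln (?F x)) \<partial>torus I)"
  proof (rule integral_mono[OF qi])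
    show "integrable (torus I) (\<lambda>x. 2 * max 0 (ln (?F x)))" using Fi by simp
    fix x
    have s0: "0 \<le> s x" using m k by (simp add: s_def)
    have "P * (s x - 1) - Q * (s x - 1) ^ 2 \<le> max 0 (ln (s x))"
      unfolding P_def Q_def using c s0 by (intro hermite_le_log) auto
    also have "\<dots> \<le> 2 * max 0 (ln (?F x))"
    proof (cases "?F x = 0")
      case False
      have "s x \<le> 1 * ?F x ^ 2" unfolding s_def using m k by (intro mult_right_mono) auto
      moreover have "0 < s x" using False m k by (simp add: s_def)
      ultimately have "ln (s x) \<le> ln (?F x ^ 2)" by (subst ln_le_cancel_iff) auto
      also have "\<dots> = 2 * ln (?F x)" using False by (simp add: ln_realpow)
      finally show ?thesis by (simp add: max_def)
    qed (simp add: s_def)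
    finally show "P * (s x - 1) - Q * (s x - 1) ^ 2 \<le> 2 * max 0 (ln (?F x))" .
  qed
  also have "\<dots> = 2 * (\<integral>x. max 0 (ln (?F x)) \<partial>torus I)" by simp
  finally show ?thesis using lower by (simp add: P_def Q_def)
qed

lemma cyclovariety_mahler_ge:
  assumes prim: "primitive_root_of_unity k z" and k: "k \<ge> 3"
  shows "29 / 100 \<le> cyclovariety_mahler k z"
proof -
  let ?A = "cyclo_exponents k z"
  have keys: "\<And>a. a \<in> ?A \<Longrightarrow> Poly_Mapping.keys a \<subseteq> {1..totient k}" by (auto simp: cyclo_exponents_def)
  note A = cyclo_exponents_finite[OF prim]
  let ?E = "card {(a, b, c, d). a \<in> ?A \<and> b \<in> ?A \<and> c \<in> ?A \<and> d \<in> ?A \<and> a + b = c + d}"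
  have E: "real ?E \<le> (if odd k then 2 else 3) * real k ^ 2"
  proof -
    have "real ?E \<le> real ((if odd k then 2 else 3) * k ^ 2)"
      using cyclo_exponents_energy[OF prim] by (simp only: of_nat_le_iff)
    then show ?thesis by (auto split: if_splits)
  qed
  show ?thesis
  proof (cases "odd k")
    case True
    have "(hermite_slope 8 * (3 - 1) - hermite_curv 8 * (2 * 3 ^ 2 - 2 * 3 + 1)) / 2
        \<le> cyclovariety_mahler k z"
      unfolding cyclovariety_mahler_eq
      using A k E True hermite_8 by (intro mean_log_ge_of_moments keys) auto
    then show ?thesis using hermite_8(5) by (simp add: algebra_simps)
  next
    case False
    \<comment> \<open>The larger energy of an even \<open>k\<close> is compensated by rescaling to mean 4, possible because \<open>k \<ge> 4\<close>.\<close>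
    then have "k \<noteq> 3" by auto
    then have k4: "k \<ge> 4" using k by simp
    have "(hermite_slope 16 * (4 - 1) - hermite_curv 16 * (3 * 4 ^ 2 - 2 * 4 + 1)) / 2
        \<le> cyclovariety_mahler k z"
      unfolding cyclovariety_mahler_eq
      using A k4 E False hermite_16 by (intro mean_log_ge_of_moments keys) auto
    then show ?thesis using hermite_16(5) by (simp add: algebra_simps)
  qed
qed

section \<open>The case of two variables\<close>

lemma integral_circle_continuous:
  fixes f :: "complex \<Rightarrow> real"
  assumes f: "continuous_on UNIV f"
  shows "(\<integral>z. f z \<partial>circle_haar) = integral {0..2*pi} (\<lambda>t. f (cis t)) / (2 * pi)"
proof -
  have [measurable]: "f \<in> borel_measurable borel" using f by (rule borel_measurable_continuous_onI)
  have "(\<integral>z. f z \<partial>circle_haar) = (\<integral>t. f (cis t) \<partial>uniform_measure lborel {0..2*pi})"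
    unfolding circle_haar_def
    by (rule integral_distr) (auto intro!: measurable_cis_circle measurable_restrict_space1)
  also have "uniform_measure lborel {0..2*pi} = density lborel (\<lambda>t. ennreal (indicator {0..2*pi} t / (2 * pi)))"
    unfolding uniform_measure_def
    by (rule arg_cong2[where f = density]) (auto simp: fun_eq_iff divide_ennreal split: split_indicator simp flip: ennreal_1)
  also have "(\<integral>t. f (cis t) \<partial>density lborel (\<lambda>t. ennreal (indicator {0..2*pi} t / (2 * pi))))
      = (\<integral>t. (indicator {0..2*pi} t / (2 * pi)) *\<^sub>R f (cis t) \<partial>lborel)"
    by (rule integral_density) auto
  also have "\<dots> = (\<integral>t. (indicator {0..2*pi} t *\<^sub>R f (cis t)) / (2 * pi) \<partial>lborel)"
    by (rule Bochner_Integration.integral_cong) auto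
  also have "\<dots> = (\<integral>t\<in>{0..2*pi}. f (cis t) \<partial>lborel) / (2 * pi)"
    by (simp add: set_lebesgue_integral_def)
  also have "(\<integral>t\<in>{0..2*pi}. f (cis t) \<partial>lborel) = integral {0..2*pi} (\<lambda>t. f (cis t))"
  proof (rule set_borel_integral_eq_integral)
    have "continuous_on {0..2*pi} (\<lambda>t. f (cis t))"
      by (intro continuous_on_compose2[OF f] continuous_intros) auto
    then show "set_integrable lborel {0..2*pi} (\<lambda>t. f (cis t))" by (rule borel_integrable_atLeastAtMost')
  qed
  finally show ?thesis .
qed

text \<open>Adding up the values of the integrand on congruent pieces before estimating turns a sum of logarithms of
sines into the logarithm of a product that trigonometric identities evaluate.\<close>

lemma integral_equal_parts:
  fixes g :: "real \<Rightarrow> real"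
  assumes g: "continuous_on UNIV g" and w: "w \<ge> 0"
  shows "integral {a..a + real n * w} g = integral {0..w} (\<lambda>v. \<Sum>j<n. g (a + real j * w + v))"
proof (induction n)
  case (Suc n)
  let ?b = "a + real n * w"
  have gi: "g integrable_on {x..y}" for x y
    by (intro integrable_continuous_interval continuous_on_subset[OF g]) auto
  have gs: "(\<lambda>v. g (x + v)) integrable_on {0..w}" for x
    by (intro integrable_continuous_interval continuous_on_compose2[OF g] continuous_intros) auto
  have "a \<le> ?b" "?b \<le> a + real (Suc n) * w" using w by (auto simp: algebra_simps)
  from Henstock_Kurzweil_Integration.integral_combine[OF this gi]
  have "integral {a..a + real (Suc n) * w} g = integral {a..?b} g + integral {?b..a + real (Suc n) * w} g" by simp
  also have "integral {?b..a + real (Suc n) * w} g = integral {0..w} (\<lambda>v. g (?b + v))"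
    using integral_shift[of 0 ?b w g] continuous_on_subset[OF g subset_UNIV]
    by (simp add: algebra_simps comp_def)
  also have "integral {a..?b} g + integral {0..w} (\<lambda>v. g (?b + v))
      = integral {0..w} (\<lambda>v. (\<Sum>j<n. g (a + real j * w + v)) + g (?b + v))"
    unfolding Suc by (intro Henstock_Kurzweil_Integration.integral_add[symmetric] integrable_sum gs) auto
  finally show ?case by simp
qed simp

text \<open>Taking the maximum inside the logarithm makes the continuity of \<open>max 0 (ln |1 - cis t|)\<close> evident.\<close>

definition chord_log :: "real \<Rightarrow> real" where
  "chord_log t = ln (max 1 (cmod (1 - cis t)))"

lemma continuous_chord_log: "continuous_on UNIV chord_log"
  unfolding chord_log_def by (intro continuous_intros) auto

lemma chord_length: "0 \<le> t \<Longrightarrow> t \<le> 2 * pi \<Longrightarrow> cmod (1 - cis t) = 2 * sin (t / 2)"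
proof -
  assume t: "0 \<le> t" "t \<le> 2 * pi"
  have s: "0 \<le> sin (t / 2)" using t by (intro sin_ge_zero) auto
  have "cmod (1 - cis t) ^ 2 = (1 - cos t) ^ 2 + sin t ^ 2" by (simp add: cmod_power2)
  also have "\<dots> = 2 - 2 * cos (2 * (t / 2))"
    using sin_cos_squared_add[of t] by (simp add: power2_eq_square algebra_simps)
  also have "\<dots> = (2 * sin (t / 2)) ^ 2" by (simp only: cos_double_sin) (simp add: power2_eq_square algebra_simps)
  finally show ?thesis by (rule power2_eq_imp_eq) (use s in auto)
qed

lemma max_0_ln_eq: "0 \<le> y \<Longrightarrow> max 0 (ln y) = ln (max 1 (y::real))"
proof (cases "y \<le> 1")
  case True
  moreover assume "0 \<le> y"
  ultimately have "ln y \<le> 0" by (cases "y = 0") auto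
  then show ?thesis using True by simp
next
  case False
  then have "0 \<le> ln y" by simp
  then show ?thesis using False by simp
qed

text \<open>On the circle \<open>|z + 1 / z| = |z\<^sup>2 + 1|\<close>; squaring and \<open>z \<mapsto> - z\<close> replace \<open>z\<^sup>2 + 1\<close> by \<open>1 - z\<close>.\<close>

lemma mahler_chord:
  "(\<integral>z. max 0 (ln (cmod (z + inverse z))) \<partial>circle_haar) = integral {0..2*pi} chord_log / (2 * pi)"
proof -
  define h where "h = (\<lambda>w. max 0 (ln (cmod (w + 1))))"
  have h: "h \<in> borel_measurable borel" unfolding h_def by measurable
  have "(\<integral>z. max 0 (ln (cmod (z + inverse z))) \<partial>circle_haar) = (\<integral>z. h (z ^ 2) \<partial>circle_haar)"
  proof (rule Bochner_Integration.integral_cong[OF refl])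
    fix z assume "z \<in> space circle_haar"
    then have z: "cmod z = 1" "z \<noteq> 0" by auto
    then have "z ^ 2 + 1 = z * (z + inverse z)" by (simp add: power2_eq_square algebra_simps)
    then show "max 0 (ln (cmod (z + inverse z))) = h (z ^ 2)" using z by (simp add: h_def norm_mult)
  qed
  also have "\<dots> = (\<integral>z. h z \<partial>circle_haar)" by (rule integral_circle_square[OF h])
  also have "\<dots> = (\<integral>z. h (- z) \<partial>circle_haar)" by (rule integral_circle_minus[OF h, symmetric])
  also have "\<dots> = (\<integral>z. ln (max 1 (cmod (1 - z))) \<partial>circle_haar)" by (simp add: h_def max_0_ln_eq)
  also have "\<dots> = integral {0..2*pi} (\<lambda>t. ln (max 1 (cmod (1 - cis t)))) / (2 * pi)"
    by (rule integral_circle_continuous) (intro continuous_intros; auto)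
  finally show ?thesis by (simp add: chord_log_def[abs_def])
qed

lemma sin_ge_half: "pi / 6 \<le> x \<Longrightarrow> x \<le> 5 * pi / 6 \<Longrightarrow> 1 / 2 \<le> sin x"
proof -
  assume x: "pi / 6 \<le> x" "x \<le> 5 * pi / 6"
  have "\<bar>pi / 2 - x\<bar> \<le> pi / 3" using x by (intro abs_leI) auto
  then have "cos (pi / 3) \<le> cos \<bar>pi / 2 - x\<bar>" by (intro cos_monotone_0_pi_le) auto
  then show ?thesis by (simp add: cos_60 sin_cos_eq)
qed

lemma sin_le_half: "0 \<le> x \<Longrightarrow> x \<le> pi / 6 \<Longrightarrow> sin x \<le> 1 / 2"
  using sin_monotone_2pi_le[of x "pi / 6"] by (simp add: sin_30)

text \<open>On the two outer arcs the chord is at most 1.\<close>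

lemma chord_log_integral_middle:
  "integral {0..2*pi} chord_log = integral {pi / 3..5 * pi / 3} chord_log"
proof -
  have gi: "chord_log integrable_on {x..y}" for x y
    by (intro integrable_continuous_interval continuous_on_subset[OF continuous_chord_log]) auto
  have z: "chord_log t = 0" if "t \<in> {0..pi / 3} \<union> {5 * pi / 3..2 * pi}" for t
  proof -
    have "sin (t / 2) \<le> 1 / 2"
    proof (cases "t \<le> pi / 3")
      case True
      then show ?thesis using that by (intro sin_le_half) auto
    next
      case False
      then have "sin (pi - t / 2) \<le> 1 / 2" using that by (intro sin_le_half) auto
      then show ?thesis by simp
    qed
    moreover have "cmod (1 - cis t) = 2 * sin (t / 2)" using that by (intro chord_length) auto
    ultimately show ?thesis by (simp add: chord_log_def)
  qed
  have "integral {0..2*pi} chord_log = integral {0..pi / 3} chord_log + integral {pi / 3..2 * pi} chord_log"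
    using Henstock_Kurzweil_Integration.integral_combine[of 0 "pi / 3" "2 * pi" chord_log] gi by simp
  also have "integral {pi / 3..2 * pi} chord_log
      = integral {pi / 3..5 * pi / 3} chord_log + integral {5 * pi / 3..2 * pi} chord_log"
    using Henstock_Kurzweil_Integration.integral_combine[of "pi / 3" "5 * pi / 3" "2 * pi" chord_log] gi by simp
  also have "integral {0..pi / 3} chord_log = integral {0..pi / 3} (\<lambda>_. 0)"
    using z by (intro integral_cong) auto
  also have "integral {5 * pi / 3..2 * pi} chord_log = integral {5 * pi / 3..2 * pi} (\<lambda>_. 0)"
    using z by (intro integral_cong) auto
  finally show ?thesis by simp
qed

lemma two_sin_product:
  "(2 * sin (a / 2)) * (2 * sin (b / 2)) = 2 * (cos ((a - b) / 2) - cos ((a + b) / 2))" for a b :: real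
proof -
  have "sin (a / 2) * sin (b / 2) = (cos (a / 2 - b / 2) - cos (a / 2 + b / 2)) / 2"
    by (rule sin_times_sin)
  then show ?thesis by (simp add: diff_divide_distrib add_divide_distrib)
qed

lemma chord_log_eq_ln_sin:
  assumes "pi / 3 \<le> t" "t \<le> 5 * pi / 3"
  shows "chord_log t = ln (2 * sin (t / 2))" "1 \<le> 2 * sin (t / 2)"
proof -
  show s: "1 \<le> 2 * sin (t / 2)" using sin_ge_half[of "t / 2"] assms by simp
  have "cmod (1 - cis t) = 2 * sin (t / 2)" using assms by (intro chord_length) auto
  then show "chord_log t = ln (2 * sin (t / 2))" using s by (simp add: chord_log_def)
qed

text \<open>Four arcs of length \<open>pi / 3\<close>.  Pairing each arc with its mirror image turns the product of the four chords
into a function of \<open>cos (pi / 6 - v)\<close>, which is least at the two ends of the range of \<open>v\<close>; there the product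
is 6.\<close>

lemma chord_log_integral_ge: "pi / 3 * ln 6 \<le> integral {0..2*pi} chord_log"
proof -
  let ?G = "\<lambda>v. \<Sum>j<4. chord_log (pi / 3 + real j * (pi / 3) + v)"
  have "integral {0..2*pi} chord_log = integral {pi / 3..pi / 3 + real 4 * (pi / 3)} chord_log"
    unfolding chord_log_integral_middle by simp
  also have "\<dots> = integral {0..pi / 3} ?G"
    by (rule integral_equal_parts[OF continuous_chord_log]) simp
  finally have eq: "integral {0..2*pi} chord_log = integral {0..pi / 3} ?G" .
  have "integral {0..pi / 3} (\<lambda>v. ln 6) \<le> integral {0..pi / 3} ?G"
  proof (rule integral_le)
    show "?G integrable_on {0..pi / 3}"
      by (intro integrable_continuous_interval continuous_intros continuous_on_compose2[OF continuous_chord_log]) auto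
    fix v assume v: "v \<in> {0..pi / 3}"
    define s where "s = (\<lambda>a. 2 * sin ((a + v) / 2))"
    have G: "?G v = chord_log (pi / 3 + v) + chord_log (2 * pi / 3 + v) + chord_log (pi + v) + chord_log (4 * pi / 3 + v)"
      by (simp add: eval_nat_numeral algebra_simps)
    have s: "chord_log (a + v) = ln (s a)" "0 < s a" if "pi / 3 \<le> a" "a \<le> 4 * pi / 3" for a
      using chord_log_eq_ln_sin[of "a + v"] v that by (auto simp: s_def)
    have c: "sqrt 3 / 2 \<le> cos (pi / 6 - v)"
    proof -
      have "\<bar>pi / 6 - v\<bar> \<le> pi / 6" using v by (intro abs_leI) auto
      then have "cos (pi / 6) \<le> cos \<bar>pi / 6 - v\<bar>" by (intro cos_monotone_0_pi_le) auto
      then show ?thesis by (simp add: cos_30)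
    qed
    have m: "cos (5 * pi / 6 + v) = - cos (pi / 6 - v)"
    proof -
      have "5 * pi / 6 + v = pi - (pi / 6 - v)" by simp
      then show ?thesis by (simp only: cos_pi_minus)
    qed
    have "s (pi / 3) * s (4 * pi / 3) = 2 * (cos (- (pi / 2)) - cos (5 * pi / 6 + v))"
      unfolding s_def two_sin_product by (rule arg_cong2[where f = "\<lambda>x y. 2 * (cos x - cos y)"]) (simp_all add: field_simps)
    then have p1: "s (pi / 3) * s (4 * pi / 3) \<ge> sqrt 3" unfolding m using c by simp
    have "s (2 * pi / 3) * s pi = 2 * (cos (- (pi / 6)) - cos (5 * pi / 6 + v))"
      unfolding s_def two_sin_product by (rule arg_cong2[where f = "\<lambda>x y. 2 * (cos x - cos y)"]) (simp_all add: field_simps)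
    then have p2: "s (2 * pi / 3) * s pi \<ge> 2 * sqrt 3" unfolding m using c by (simp add: cos_30)
    have "6 = sqrt 3 * (2 * sqrt 3)" by simp
    also have "\<dots> \<le> (s (pi / 3) * s (4 * pi / 3)) * (s (2 * pi / 3) * s pi)"
      by (rule mult_mono[OF p1 p2]) (auto intro!: mult_pos_pos less_imp_le s(2))
    finally have "ln 6 \<le> ln ((s (pi / 3) * s (4 * pi / 3)) * (s (2 * pi / 3) * s pi))"
      by (subst ln_le_cancel_iff) auto
    also have "\<dots> = ?G v"
      unfolding G using s[of "pi / 3"] s[of "2 * pi / 3"] s[of pi] s[of "4 * pi / 3"] by (simp add: ln_mult)
    finally show "ln 6 \<le> ?G v" .
  qed (rule integrable_const_ivl)
  then show ?thesis unfolding eq by simp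
qed

text \<open>The number is a zero of \<open>4 y\<^sup>3 - 3 y + 1 / 2\<close>, which is positive at 0.77 and increasing from there on.\<close>

lemma cos_40_le: "cos (2 * pi / 9) \<le> 77 / 100"
proof (rule ccontr)
  define y where "y = cos (2 * pi / 9)"
  assume "\<not> ?thesis"
  then have y: "y > 77 / 100" by (simp add: y_def)
  have "cos (3 * (2 * pi / 9)) = 4 * y ^ 3 - 3 * y" unfolding y_def by (rule cos_treble_cos)
  moreover have "cos (3 * (2 * pi / 9)) = - 1 / 2" using cos_120 by simp
  ultimately have eq: "4 * y ^ 3 - 3 * y = - 1 / 2" by simp
  have "(77 / 100) ^ 2 \<le> y ^ 2" using y by (intro power_mono) auto
  then have "0 \<le> (y - 77 / 100) * (4 * (y ^ 2 + 77 / 100 * y + (77 / 100) ^ 2) - 3)"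
    using y by (intro mult_nonneg_nonneg) (auto simp: power2_eq_square)
  also have "\<dots> = (4 * y ^ 3 - 3 * y) - (4 * (77 / 100) ^ 3 - 3 * (77 / 100))"
    by (simp add: power2_eq_square power3_eq_cube field_simps)
  finally show False unfolding eq by (simp add: power3_eq_cube)
qed

text \<open>The left-hand side equals \<open>3 (1 + 2 cos (2 pi / 9))\<^sup>2\<close>.\<close>

lemma chord_product_le: "3 * (2 * (cos (5 * pi / 9) + 1)) * (2 * (cos (pi / 9) + 1)) \<le> exp (297 / 100)"
proof -
  define y where "y = cos (2 * pi / 9)"
  have sum: "cos (5 * pi / 9) + cos (pi / 9) = y"
  proof -
    have "cos (5 * pi / 9) + cos (pi / 9) = 2 * cos ((5 * pi / 9 + pi / 9) / 2) * cos ((5 * pi / 9 - pi / 9) / 2)"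
      by (rule cos_plus_cos)
    also have "(5 * pi / 9 + pi / 9) / 2 = pi / 3" by simp
    also have "(5 * pi / 9 - pi / 9) / 2 = 2 * pi / 9" by simp
    finally show ?thesis by (simp add: y_def cos_60)
  qed
  have prod: "cos (5 * pi / 9) * cos (pi / 9) = y ^ 2 - 3 / 4"
  proof -
    have "cos (5 * pi / 9) * cos (pi / 9) = (cos (5 * pi / 9 - pi / 9) + cos (5 * pi / 9 + pi / 9)) / 2"
      by (rule cos_times_cos)
    also have "5 * pi / 9 - pi / 9 = 2 * (2 * pi / 9)" by simp
    also have "5 * pi / 9 + pi / 9 = 2 * pi / 3" by simp
    finally show ?thesis unfolding cos_double_cos cos_120 y_def by (simp add: field_simps)
  qed
  have y0: "0 \<le> y" unfolding y_def by (rule cos_ge_zero) (use pi_gt_zero in linarith)+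
  have y: "y \<le> 77 / 100" unfolding y_def by (rule cos_40_le)
  have "3 * (2 * (cos (5 * pi / 9) + 1)) * (2 * (cos (pi / 9) + 1))
      = 12 * (cos (5 * pi / 9) * cos (pi / 9) + (cos (5 * pi / 9) + cos (pi / 9)) + 1)"
    by (simp add: algebra_simps)
  also have "\<dots> = 3 * (1 + 2 * y) ^ 2" unfolding sum prod by (simp add: power2_eq_square algebra_simps)
  also have "\<dots> \<le> 3 * (254 / 100) ^ 2" using y0 y by (intro mult_left_mono power_mono) auto
  also have "\<dots> \<le> (2718 / 1000) ^ 3 * (1 + (- 3 / 100))" by (simp add: power2_eq_square power3_eq_cube)
  also have "\<dots> \<le> exp 1 ^ 3 * exp (- 3 / 100)"
  proof (rule mult_mono)
    have "- (exp 1 - 5837465777 / 2147483648) \<le> (inverse (2 ^ 32) :: real)"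
      using e_approx_32 by (rule abs_le_D2)
    then have "2718 / 1000 \<le> (exp 1 :: real)" by simp
    then show "(2718 / 1000) ^ 3 \<le> (exp 1 :: real) ^ 3" by (intro power_mono) auto
    show "1 + (- 3 / 100) \<le> exp (- 3 / 100 :: real)" by (rule exp_ge_add_one_self)
  qed auto
  also have "\<dots> = exp (297 / 100)"
    by (simp flip: exp_of_nat_mult exp_add)
  finally show ?thesis .
qed

text \<open>Six arcs of length \<open>2 pi / 9\<close>, each paired with its mirror image.  The product of a pair of chords is largest
at the midpoints of the arcs, and the product of the three maxima stays below \<open>exp 2.97\<close>.  Five arcs
would give 0.331 in place of 0.33.\<close>

lemma chord_log_integral_le: "integral {0..2*pi} chord_log \<le> 2 * pi / 9 * (297 / 100)"
proof -
  let ?w = "2 * pi / 9"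
  let ?G = "\<lambda>v. \<Sum>j<6. chord_log (pi / 3 + real j * ?w + v)"
  have "integral {0..2*pi} chord_log = integral {pi / 3..pi / 3 + real 6 * ?w} chord_log"
    unfolding chord_log_integral_middle by simp
  also have "\<dots> = integral {0..?w} ?G"
    by (rule integral_equal_parts[OF continuous_chord_log]) simp
  finally have eq: "integral {0..2*pi} chord_log = integral {0..?w} ?G" .
  have "integral {0..?w} ?G \<le> integral {0..?w} (\<lambda>v. 297 / 100)"
  proof (rule integral_le)
    show "?G integrable_on {0..?w}"
      by (intro integrable_continuous_interval continuous_intros continuous_on_compose2[OF continuous_chord_log]) auto
    fix v assume v: "v \<in> {0..?w}"
    define s where "s = (\<lambda>a. 2 * sin ((a + v) / 2))"
    have G: "?G v = chord_log (pi / 3 + v) + chord_log (5 * pi / 9 + v) + chord_log (7 * pi / 9 + v)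
        + chord_log (pi + v) + chord_log (11 * pi / 9 + v) + chord_log (13 * pi / 9 + v)"
      by (simp add: eval_nat_numeral algebra_simps)
    have s: "chord_log (a + v) = ln (s a)" "0 < s a" if "pi / 3 \<le> a" "a \<le> 13 * pi / 9" for a
      using chord_log_eq_ln_sin[of "a + v"] v that by (auto simp: s_def)
    have pair: "s a * s b \<le> 2 * (cos c + 1)" if "a - b = - 2 * c" for a b c
    proof -
      define m where "m = (a + v + (b + v)) / 2"
      have "((a + v) - (b + v)) / 2 = - c" using that by simp
      then have "s a * s b = 2 * (cos (- c) - cos m)"
        unfolding s_def m_def two_sin_product by (simp only:)
      also have "\<dots> \<le> 2 * (cos (- c) - (- 1))"
        by (intro mult_left_mono diff_left_mono cos_ge_minus_one) simp
      finally show ?thesis by simp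
    qed
    have p1: "s (pi / 3) * s (13 * pi / 9) \<le> 2 * (cos (5 * pi / 9) + 1)" by (rule pair) simp
    have p2: "s (5 * pi / 9) * s (11 * pi / 9) \<le> 2 * (cos (pi / 3) + 1)" by (rule pair) simp
    then have p2: "s (5 * pi / 9) * s (11 * pi / 9) \<le> 3" by (simp add: cos_60)
    have p3: "s (7 * pi / 9) * s pi \<le> 2 * (cos (pi / 9) + 1)" by (rule pair) simp
    note pos = s[of "pi / 3"] s[of "5 * pi / 9"] s[of "7 * pi / 9"] s[of pi] s[of "11 * pi / 9"] s[of "13 * pi / 9"]
    let ?P = "(s (5 * pi / 9) * s (11 * pi / 9)) * (s (pi / 3) * s (13 * pi / 9)) * (s (7 * pi / 9) * s pi)"
    have P0: "0 < ?P" using pos by simp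
    have "?G v = ln ?P" unfolding G using pos by (simp add: ln_mult)
    also have "ln ?P \<le> ln (exp (297 / 100))"
    proof -
      have "?P \<le> 3 * (2 * (cos (5 * pi / 9) + 1)) * (2 * (cos (pi / 9) + 1))"
      proof (rule mult_mono[OF mult_mono[OF p2 p1] p3])
        have "0 < s (pi / 3) * s (13 * pi / 9)" using pos by simp
        then show "0 \<le> s (pi / 3) * s (13 * pi / 9)" by (rule less_imp_le)
        have "0 < 2 * (cos (5 * pi / 9) + 1)" using \<open>0 < s (pi / 3) * s (13 * pi / 9)\<close> p1 by (rule less_le_trans)
        then show "0 \<le> 3 * (2 * (cos (5 * pi / 9) + 1))" by (intro mult_nonneg_nonneg less_imp_le) auto
        have "0 < s (7 * pi / 9) * s pi" using pos by simp
        then show "0 \<le> s (7 * pi / 9) * s pi" by (rule less_imp_le)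
      qed simp
      also note chord_product_le
      finally show ?thesis using P0 by (subst ln_le_cancel_iff) auto
    qed
    finally show "?G v \<le> 297 / 100" by simp
  qed (rule integrable_const_ivl)
  then show ?thesis unfolding eq by simp
qed

lemma totient_two: "totient 2 = 1"
  by (simp add: totient_prime)

lemma cyclo_exponents_2:
  "cyclo_exponents 2 z = {Poly_Mapping.single 1 1, Poly_Mapping.single 1 (- 1)}"
proof (intro equalityI subsetI)
  fix a assume "a \<in> cyclo_exponents 2 z"
  then have k: "Poly_Mapping.keys a \<subseteq> {1}" and s: "complex_of_int (Poly_Mapping.lookup a 1) ^ 2 = 1"
    by (simp_all add: cyclo_exponents_def totient_two)
  define c where "c = Poly_Mapping.lookup a 1"
  have a: "a = Poly_Mapping.single 1 c"
    using k by (intro poly_mapping_eqI) (auto simp: c_def lookup_single when_def in_keys_iff)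
  have "c ^ 2 = 1" using s unfolding c_def by (metis of_int_eq_1_iff of_int_power)
  then have "c = 1 \<or> c = - 1" by (simp add: power2_eq_1_iff)
  then show "a \<in> {Poly_Mapping.single 1 1, Poly_Mapping.single 1 (- 1)}" unfolding a by auto
qed (auto simp: cyclo_exponents_def totient_two)

lemma cyclovariety_mahler_2: "cyclovariety_mahler 2 z = integral {0..2*pi} chord_log / (2 * pi)"
proof -
  interpret product_sigma_finite "\<lambda>i::nat. circle_haar" by (rule product_sigma_finite_circle)
  have ne: "Poly_Mapping.single (1::nat) (1::int) \<noteq> Poly_Mapping.single 1 (- 1)"
    by (metis lookup_single_eq one_neq_neg_one)
  have F: "exponential_sum (cyclo_exponents 2 z) x = x 1 + inverse (x 1)" for x
    using ne by (simp add: exponential_sum_def cyclo_exponents_2 monomial_value_def)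
  have m: "(\<lambda>z::complex. max 0 (ln (cmod (z + inverse z)))) \<in> borel_measurable borel" by measurable
  have "cyclovariety_mahler 2 z = (\<integral>x. max 0 (ln (cmod (x 1 + inverse (x 1)))) \<partial>torus {1})"
    unfolding cyclovariety_mahler_eq F by (simp add: totient_two)
  also have "\<dots> = (\<integral>z. max 0 (ln (cmod (z + inverse z))) \<partial>circle_haar)"
    using product_integral_singleton[OF measurable_circle[OF m]] .
  finally show ?thesis unfolding mahler_chord .
qed

lemma cyclovariety_mahler_2_bounds:
  "29 / 100 \<le> cyclovariety_mahler 2 z" "cyclovariety_mahler 2 z \<le> 33 / 100"
proof -
  have "pi / 3 * ln 6 / (2 * pi) \<le> cyclovariety_mahler 2 z"
    unfolding cyclovariety_mahler_2 using chord_log_integral_ge by (intro divide_right_mono) auto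
  moreover have "pi / 3 * ln 6 / (2 * pi) = ln 6 / 6" by simp
  moreover have "174 / 100 \<le> ln (6 :: real)"
  proof -
    have e: "exp 1 \<le> (272 / 100 :: real)" using e_less_272 by simp
    have "exp (174 / 100 :: real) ^ 50 = exp 1 ^ 87" by (simp flip: exp_of_nat_mult)
    also have "\<dots> \<le> (272 / 100) ^ 87" using e by (intro power_mono) auto
    also have "\<dots> \<le> 6 ^ 50" by (simp add: power_divide divide_le_eq)
    finally have "exp (174 / 100) \<le> (6 :: real)" by (intro power_le_imp_le_base[of "exp (174 / 100)" 49]) auto
    then have "ln (exp (174 / 100)) \<le> ln (6 :: real)" by (subst ln_le_cancel_iff) auto
    then show ?thesis by simp
  qed
  ultimately show "29 / 100 \<le> cyclovariety_mahler 2 z" by simp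
  have "cyclovariety_mahler 2 z \<le> 2 * pi / 9 * (297 / 100) / (2 * pi)"
    unfolding cyclovariety_mahler_2 using chord_log_integral_le by (intro divide_right_mono) auto
  then show "cyclovariety_mahler 2 z \<le> 33 / 100" by simp
qed

section \<open>The smallest Pisot number\<close>

lemma plastic_number_exists:
  "\<exists>\<theta>::real. 13236 / 10000 \<le> \<theta> \<and> \<theta> \<le> 1325 / 1000 \<and> \<theta> ^ 3 = \<theta> + 1"
proof -
  define p where "p = (\<lambda>x::real. x ^ 3 - x - 1)"
  have "\<exists>x\<ge>13236 / 10000. x \<le> 1325 / 1000 \<and> p x = 0"
    by (rule IVT') (auto simp: p_def power3_eq_cube intro!: continuous_intros)
  then obtain x where "13236 / 10000 \<le> x" "x \<le> 1325 / 1000" "p x = 0" by blast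
  then have "x ^ 3 = x + 1" by (simp add: p_def)
  then show ?thesis using \<open>13236 / 10000 \<le> x\<close> \<open>x \<le> 1325 / 1000\<close> by blast
qed

text \<open>Besides \<open>\<theta>\<close> the polynomial has two complex conjugate roots with product \<open>\<theta>\<^sup>2 - 1 \<le> 1\<close>.  They lie in the unit
disc and contribute nothing.\<close>

lemma mahler_plastic:
  assumes \<theta>: "1 \<le> \<theta>" "\<theta> ^ 2 \<le> 2" "4 \<le> 3 * \<theta> ^ 2" "\<theta> ^ 3 = \<theta> + 1"
  shows "log_mahler_measure 1 (laurent_var 0 ^ 3 - laurent_var 0 - 1) = ln \<theta>"
proof -
  interpret product_sigma_finite "\<lambda>i::nat. circle_haar" by (rule product_sigma_finite_circle)
  define \<beta> where "\<beta> = Complex (- \<theta> / 2) (sqrt (3 * \<theta> ^ 2 / 4 - 1))"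
  have n2: "cmod \<beta> ^ 2 = \<theta> ^ 2 - 1"
    using \<theta>(3) by (simp add: \<beta>_def cmod_power2 power_divide)
  have \<beta>: "cmod \<beta> \<le> 1"
  proof -
    have "cmod \<beta> ^ 2 \<le> 1 ^ 2" using n2 \<theta>(2) by simp
    then show ?thesis by (rule power2_le_imp_le) simp
  qed
  have sum: "\<beta> + cnj \<beta> = - of_real \<theta>" by (simp add: \<beta>_def complex_eq_iff)
  have prod: "\<beta> * cnj \<beta> = of_real \<theta> ^ 2 - 1"
    using n2 by (metis complex_norm_square of_real_1 of_real_diff of_real_power)
  have cub: "complex_of_real \<theta> ^ 3 = of_real \<theta> + 1"
    using \<theta>(4) by (metis of_real_1 of_real_add of_real_power)
  have fact: "z ^ 3 - z - 1 = (z - of_real \<theta>) * (z - \<beta>) * (z - cnj \<beta>)" for z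
  proof -
    have "(z - \<beta>) * (z - cnj \<beta>) = z ^ 2 - (\<beta> + cnj \<beta>) * z + \<beta> * cnj \<beta>"
      by (simp add: power2_eq_square algebra_simps)
    then have "(z - of_real \<theta>) * ((z - \<beta>) * (z - cnj \<beta>)) = (z - of_real \<theta>) * (z ^ 2 + of_real \<theta> * z + (of_real \<theta> ^ 2 - 1))"
      unfolding sum prod by simp
    also have "\<dots> = z ^ 3 - z - (of_real \<theta> ^ 3 - of_real \<theta>)"
      by (simp add: power2_eq_square power3_eq_cube algebra_simps)
    finally show ?thesis unfolding cub by (simp add: mult.assoc)
  qed
  have I: "{..<1} = {0::nat}" by auto
  have m: "(\<lambda>z. ln (cmod (z ^ 3 - z - 1))) \<in> borel_measurable borel" by measurable
  have "log_mahler_measure 1 (laurent_var 0 ^ 3 - laurent_var 0 - 1)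
      = (\<integral>x. ln (cmod (x 0 ^ 3 - x 0 - 1)) \<partial>torus {0})"
    unfolding log_mahler_measure_def I laurent_eval_diff laurent_eval_var laurent_eval_var_cubed laurent_eval_1 ..
  also have "\<dots> = (\<integral>z. ln (cmod (z ^ 3 - z - 1)) \<partial>circle_haar)"
    using product_integral_singleton[OF measurable_circle[OF m]] .
  also have "\<dots> = (\<integral>z. ln (cmod (z - of_real \<theta>)) + ln (cmod (z - \<beta>)) + ln (cmod (z - cnj \<beta>)) \<partial>circle_haar)"
  proof (rule integral_cong_AE)
    show "AE z in circle_haar. ln (cmod (z ^ 3 - z - 1))
        = ln (cmod (z - of_real \<theta>)) + ln (cmod (z - \<beta>)) + ln (cmod (z - cnj \<beta>))"
      using AE_circle_neq[of "of_real \<theta>"] AE_circle_neq[of \<beta>] AE_circle_neq[of "cnj \<beta>"]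
      by eventually_elim (simp add: fact norm_mult ln_mult)
  qed (intro measurable_circle; measurable)+
  also have "\<dots> = (\<integral>z. ln (cmod (z - of_real \<theta>)) \<partial>circle_haar) + (\<integral>z. ln (cmod (z - \<beta>)) \<partial>circle_haar)
      + (\<integral>z. ln (cmod (z - cnj \<beta>)) \<partial>circle_haar)"
    by (simp add: integrable_log_dist)
  also have "\<dots> = ln \<theta>"
    using \<theta>(1) \<beta> log_dist_integral_unit_disc[of \<beta>] log_dist_integral_unit_disc[of "cnj \<beta>"]
    by (simp add: integral_log_dist[of "of_real \<theta>"])
  finally show ?thesis .
qed

lemma ln_plastic_bounds:
  assumes "13236 / 10000 \<le> \<theta>" "\<theta> \<le> 1325 / (1000::real)"
  shows "28 / 100 \<le> ln \<theta>" "ln \<theta> \<le> 29 / 100"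
proof -
  have "1 + (29/100) + (29/100) ^ 2 / 2 \<le> exp (29 / 100 :: real)" by (rule exp_lower_Taylor_quadratic) simp
  then have "\<theta> \<le> exp (29 / 100)" using assms(2) by (simp add: power2_eq_square)
  then have "ln \<theta> \<le> ln (exp (29/100))" using assms(1) by (subst ln_le_cancel_iff) auto
  then show "ln \<theta> \<le> 29 / 100" by simp
  have "exp 1 - 5837465777 / 2147483648 \<le> (inverse (2 ^ 32) :: real)"
    using e_approx_32 by (rule abs_le_D1)
  then have e: "exp 1 \<le> (27183 / 10000 :: real)" by simp
  have "exp (7 / 25 :: real) ^ 25 = exp 1 ^ 7" by (simp flip: exp_of_nat_mult)
  also have "\<dots> \<le> (27183 / 10000) ^ 7" using e by (intro power_mono) auto
  also have "\<dots> \<le> (13236 / 10000) ^ 25" by (simp add: power_divide divide_le_eq)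
  also have "\<dots> \<le> \<theta> ^ 25" using assms(1) by (intro power_mono) auto
  finally have "exp (7 / 25) \<le> \<theta>" using assms(1) by (intro power_le_imp_le_base[of "exp (7 / 25)" 24]) auto
  then have "ln (exp (7 / 25)) \<le> ln \<theta>" by (subst ln_le_cancel_iff) (use assms in auto)
  then show "28 / 100 \<le> ln \<theta>" by simp
qed

section \<open>The bounds for all cyclovarieties\<close>

theorem proposition6p1p1:
  fixes \<zeta> :: "nat \<Rightarrow> complex"
  assumes "\<And>k. k \<ge> 2 \<Longrightarrow> primitive_root_of_unity k (\<zeta> k)"
  shows "(\<exists>c>0. \<forall>k\<ge>2. c \<le> cyclovariety_mahler k (\<zeta> k)) \<and>
    0.28 \<le> log_mahler_measure 1 (laurent_var 0 ^ 3 - laurent_var 0 - 1) \<and>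
    log_mahler_measure 1 (laurent_var 0 ^ 3 - laurent_var 0 - 1)
      \<le> (INF k\<in>{2..}. cyclovariety_mahler k (\<zeta> k)) \<and>
    (INF k\<in>{2..}. cyclovariety_mahler k (\<zeta> k)) \<le> cyclovariety_mahler 2 (\<zeta> 2) \<and>
    cyclovariety_mahler 2 (\<zeta> 2) \<le> 0.33"
proof -
  let ?m = "log_mahler_measure 1 (laurent_var 0 ^ 3 - laurent_var 0 - 1)"
  obtain \<theta> :: real where \<theta>: "13236 / 10000 \<le> \<theta>" "\<theta> \<le> 1325 / 1000" "\<theta> ^ 3 = \<theta> + 1"
    using plastic_number_exists by blast
  have "(13236 / 10000) ^ 2 \<le> \<theta> ^ 2" "\<theta> ^ 2 \<le> (1325 / 1000) ^ 2"
    using \<theta> by (auto intro!: power_mono)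
  then have m: "?m = ln \<theta>" using \<theta> by (intro mahler_plastic) (auto simp: power2_eq_square)
  have bound: "29 / 100 \<le> cyclovariety_mahler k (\<zeta> k)" if "k \<ge> 2" for k
    using that cyclovariety_mahler_2_bounds(1) cyclovariety_mahler_ge[OF assms[OF that]]
    by (cases "k = 2") auto
  have "?m \<le> (INF k\<in>{2..}. cyclovariety_mahler k (\<zeta> k))"
    unfolding m by (intro cINF_greatest order_trans[OF ln_plastic_bounds(2)[OF \<theta>(1,2)] bound]) auto
  moreover have "(INF k\<in>{2..}. cyclovariety_mahler k (\<zeta> k)) \<le> cyclovariety_mahler 2 (\<zeta> 2)"
    using bound by (intro cINF_lower bdd_belowI2[where m = "29 / 100"]) auto
  moreover have "\<exists>c>0. \<forall>k\<ge>2. c \<le> cyclovariety_mahler k (\<zeta> k)"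
    using bound by (intro exI[of _ "29 / 100"]) auto
  ultimately show ?thesis
    using ln_plastic_bounds(1)[OF \<theta>(1,2)] cyclovariety_mahler_2_bounds(2)[of "\<zeta> 2"] unfolding m by simp
qed

end
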